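(* Let $G$ be a fragmentation of a minimal action of the dihedral group $\langle a,b\rangle$ on a Cantor set $\mathcal{X}$. Then $G$ can be embedded into the topological full group of a minimal action of $\mathbb{Z}$ on a Cantor set, and hence $G$ is amenable.
   Context: An action by homeomorphisms is minimal if all its orbits are dense. Let $a,b$ be homeomorphisms of period two (non-identity, with square the identity) of the Cantor set $\mathcal{X}$. A fragmentation of $a$ is a finite group $A$ of homeomorphisms of $\mathcal{X}$ such that for all $h\in A$, $\zeta\in\mathcal{X}$ either $h(\zeta)=\zeta$ or $h(\zeta)=a(\zeta)$, and for every $\zeta\in\mathcal{X}$ there is $h\in A$ with $h(\zeta)=a(\zeta)$. A fragmentation of the dihedral group $\langle a,b\rangle$ is the group $\langle A\cup B\rangle$ generated by fragmentations $A$ of $a$ and $B$ of $b$. The topological full group of a group $H$ acting on a Cantor set $\mathcal{Y}$ is the group of all homeomorphisms $h$ of $\mathcal{Y}$ such that for every $\zeta\in\mathcal{Y}$ there exist a neighborhood $U$ of $\zeta$ and $g\in H$ with $h|_U=g|_U$. Embedded means that there is an injective group homomorphism. *)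

theory Defs
  imports
    "HOL-Analysis.Analysis"
    "HOL-Algebra.Group_Action"
    "HOL-Algebra.Generated_Groups"
    "HOL-Algebra.Elementary_Groups"
begin

definition cantor_set :: "'a topology \<Rightarrow> bool" where
  "cantor_set X \<longleftrightarrow>
     X homeomorphic_space product_topology (\<lambda>n::nat. discrete_topology (UNIV :: bool set)) UNIV"

text \<open>As in \<^const>\<open>BijGroup\<close>, elements are extensional functions (undefined outside the
  space), so that equality of elements is equality of maps on the space; the product is composition.\<close>

definition homeo_group :: "'a topology \<Rightarrow> ('a \<Rightarrow> 'a) monoid" where
  "homeo_group X =
     BijGroup (topspace X) \<lparr>carrier := {h \<in> Bij (topspace X). homeomorphic_map X X h}\<rparr>"

lemma homeo_group_subgroup:
  "subgroup {h \<in> Bij (topspace X). homeomorphic_map X X h} (BijGroup (topspace X))"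
proof (rule group.subgroupI[OF group_BijGroup])
  let ?S = "topspace X" and ?H = "{h \<in> Bij (topspace X). homeomorphic_map X X h}"
  show "?H \<subseteq> carrier (BijGroup ?S)"
    by (auto simp: BijGroup_def)
  have "homeomorphic_map X X (\<lambda>x\<in>?S. x)"
    using homeomorphic_map_eq[of X X id "\<lambda>x\<in>?S. x"] by simp
  then show "?H \<noteq> {}"
    using id_Bij by blast
  show "inv\<^bsub>BijGroup ?S\<^esub> h \<in> ?H" if h: "h \<in> ?H" for h
  proof -
    from h obtain g where g: "homeomorphic_maps X X h g"
      by (auto simp: homeomorphic_map_maps)
    have "homeomorphic_map X X (\<lambda>x\<in>?S. inv_into ?S h x)"
    proof (rule homeomorphic_map_eq)
      show "homeomorphic_map X X g"
        using g by (metis homeomorphic_map_maps homeomorphic_maps_sym)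
      fix y assume y: "y \<in> ?S"
      then have "g y \<in> ?S" "h (g y) = y"
        using g by (auto simp: homeomorphic_maps_def continuous_map_def)
      moreover have "inj_on h ?S"
        using h by (auto simp: Bij_def bij_betw_def)
      ultimately show "g y = (\<lambda>x\<in>?S. inv_into ?S h x) y"
        using y by (metis inv_into_f_f restrict_apply')
    qed
    then show ?thesis
      using h by (simp add: inv_BijGroup restrict_inv_into_Bij)
  qed
  show "h \<otimes>\<^bsub>BijGroup ?S\<^esub> k \<in> ?H" if h: "h \<in> ?H" and k: "k \<in> ?H" for h k
  proof -
    have "homeomorphic_map X X (compose ?S h k)"
      by (rule homeomorphic_map_eq[OF homeomorphic_map_compose[of X X k X h]])
         (use h k in \<open>auto simp: compose_def\<close>)
    then show ?thesis
      using h k by (simp add: BijGroup_def compose_Bij)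
  qed
qed

lemma group_homeo_group: "group (homeo_group X)"
  unfolding homeo_group_def
  by (rule subgroup.subgroup_is_group[OF homeo_group_subgroup group_BijGroup])

definition minimal_action ::
    "('g, 'm) monoid_scheme \<Rightarrow> 'a topology \<Rightarrow> ('g \<Rightarrow> 'a \<Rightarrow> 'a) \<Rightarrow> bool" where
  "minimal_action H X \<phi> \<longleftrightarrow>
     group_hom H (homeo_group X) \<phi> \<and>
     (\<forall>x\<in>topspace X. X closure_of (orbit H \<phi> x) = topspace X)"

definition period_two :: "'a topology \<Rightarrow> ('a \<Rightarrow> 'a) \<Rightarrow> bool" where
  "period_two X a \<longleftrightarrow>
     a \<in> carrier (homeo_group X) \<and> a \<noteq> \<one>\<^bsub>homeo_group X\<^esub> \<and>
     a \<otimes>\<^bsub>homeo_group X\<^esub> a = \<one>\<^bsub>homeo_group X\<^esub>"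

definition subgroup_generated_by :: "'a topology \<Rightarrow> ('a \<Rightarrow> 'a) set \<Rightarrow> ('a \<Rightarrow> 'a) monoid" where
  "subgroup_generated_by X S = homeo_group X \<lparr>carrier := generate (homeo_group X) S\<rparr>"

definition fragmentation :: "'a topology \<Rightarrow> ('a \<Rightarrow> 'a) \<Rightarrow> ('a \<Rightarrow> 'a) set \<Rightarrow> bool" where
  "fragmentation X a A \<longleftrightarrow>
     subgroup A (homeo_group X) \<and> finite A \<and>
     (\<forall>h\<in>A. \<forall>\<zeta>\<in>topspace X. h \<zeta> = \<zeta> \<or> h \<zeta> = a \<zeta>) \<and>
     (\<forall>\<zeta>\<in>topspace X. \<exists>h\<in>A. h \<zeta> = a \<zeta>)"

definition dihedral_fragmentation ::
    "'a topology \<Rightarrow> ('a \<Rightarrow> 'a) \<Rightarrow> ('a \<Rightarrow> 'a) \<Rightarrow> ('a \<Rightarrow> 'a) monoid \<Rightarrow> bool" where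
  "dihedral_fragmentation X a b G \<longleftrightarrow>
     (\<exists>A B. fragmentation X a A \<and> fragmentation X b B \<and> G = subgroup_generated_by X (A \<union> B))"

definition topological_full_group ::
    "('g, 'm) monoid_scheme \<Rightarrow> 'a topology \<Rightarrow> ('g \<Rightarrow> 'a \<Rightarrow> 'a) \<Rightarrow> ('a \<Rightarrow> 'a) monoid" where
  "topological_full_group H Y \<phi> = homeo_group Y \<lparr>carrier :=
     {h \<in> carrier (homeo_group Y).
        \<forall>\<zeta>\<in>topspace Y. \<exists>U g. openin Y U \<and> \<zeta> \<in> U \<and> g \<in> carrier H \<and> (\<forall>x\<in>U. h x = \<phi> g x)}\<rparr>"

text \<open>Amenability of a discrete group in von Neumann's sense: a left-invariant finitely additive
  probability measure on all subsets of the group. The values of \<^term>\<open>\<mu>\<close> outside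
  \<^term>\<open>Pow (carrier G)\<close> play no role.\<close>

definition amenable :: "('g, 'm) monoid_scheme \<Rightarrow> bool" where
  "amenable G \<longleftrightarrow> group G \<and>
     (\<exists>\<mu> :: 'g set \<Rightarrow> real.
        (\<forall>E. E \<subseteq> carrier G \<longrightarrow> 0 \<le> \<mu> E) \<and>
        \<mu> (carrier G) = 1 \<and>
        (\<forall>E F. E \<subseteq> carrier G \<longrightarrow> F \<subseteq> carrier G \<longrightarrow> E \<inter> F = {} \<longrightarrow> \<mu> (E \<union> F) = \<mu> E + \<mu> F) \<and>
        (\<forall>g\<in>carrier G. \<forall>E. E \<subseteq> carrier G \<longrightarrow> \<mu> (g <#\<^bsub>G\<^esub> E) = \<mu> E))"

end

(*
A bounded-displacement action on the integers permutes the subsets commensurable with a half-line.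
Bernoulli measures with slowly varying densities are almost invariant under this action, and if the
action is uniformly recurrent then stabilizers are locally finite: recurrence repeats an invariant
half-line with bounded gaps in both directions and so cuts the integers into bounded invariant
pieces. Hence a group acting faithfully in this way is amenable.

For the fragmentation, Baire's theorem gives a point whose dihedral orbit is a line without
reflection points. Every element of the group moves points of this line by bounded amounts; the
sequence of visited points together with these displacements has a minimal orbit closure under the
shift. The group acts on this Cantor set by locally constant powers of the shift, and faithfully
because the closure projects equivariantly onto X.
*)
theory Submission
  imports Defs
begin

section \<open>A criterion for amenability\<close>

text \<open>The integers alone do not suffice: they carry almost invariant measures, but nothing
  controls the stabilizer of an integer. Preserving a half-line is a far stronger condition, and
  half-lines still carry almost invariant measures.

  The integers cannot simply act on X. The element ab does act, but a and b reverse the lines, so an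
  element of the fragmentation becomes a power of a shift only after each line has been oriented,
  and an orientation need not depend continuously on the point. Where a line folds back, a point
  does not even determine a displacement. Hence the passage to sequences that record both the
  direction and the displacements; X is only a factor of their closure.

  Both conclusions rest on the minimality of this closure. Amenability is obtained directly from the
  displacements along the free line and does not go through the embedding.\<close>

lemma amenable_if_almost_invariant:
  fixes G :: "('g, 'm) monoid_scheme"
  assumes "group G"
    and almost: "\<And>F \<epsilon>. finite F \<Longrightarrow> F \<subseteq> carrier G \<Longrightarrow> \<epsilon> > 0 \<Longrightarrow>
      \<exists>\<mu> :: 'g set \<Rightarrow> real.
        (\<forall>E\<subseteq>carrier G. 0 \<le> \<mu> E) \<and> \<mu> (carrier G) = 1 \<and>
        (\<forall>E F. E \<subseteq> carrier G \<longrightarrow> F \<subseteq> carrier G \<longrightarrow> E \<inter> F = {} \<longrightarrow> \<mu> (E \<union> F) = \<mu> E + \<mu> F) \<and>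
        (\<forall>g\<in>F. \<forall>E\<subseteq>carrier G. \<bar>\<mu> (g <#\<^bsub>G\<^esub> E) - \<mu> E\<bar> \<le> \<epsilon>)"
  shows "amenable G"
proof -
  let ?C = "carrier G"
  define K :: "('g set \<Rightarrow> real) set" where "K = (\<Pi>\<^sub>E E\<in>UNIV. {0..1})"
  define fa :: "('g set \<Rightarrow> real) \<Rightarrow> bool" where
    "fa \<mu> \<longleftrightarrow> (\<mu> ?C = 1 \<and>
      (\<forall>E F. E \<subseteq> ?C \<longrightarrow> F \<subseteq> ?C \<longrightarrow> E \<inter> F = {} \<longrightarrow> \<mu> (E \<union> F) = \<mu> E + \<mu> F))" for \<mu>
  \<comment> \<open>Each requirement, with tolerance 1/(n+1), is closed in the cube
    \<open>K\<close>, which is compact by Tychonoff. Finitely many of them are met by a single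
    almost invariant measure, so all of them hold at once.\<close>
  define A :: "'g \<times> nat \<Rightarrow> ('g set \<Rightarrow> real) set" where
    "A = (\<lambda>(g, n). {\<mu>. fa \<mu> \<and> (\<forall>E. E \<subseteq> ?C \<longrightarrow> \<bar>\<mu> (g <#\<^bsub>G\<^esub> E) - \<mu> E\<bar> \<le> 1 / (real n + 1))})"
  have cont: "continuous_on UNIV (\<lambda>\<mu> :: 'g set \<Rightarrow> real. \<mu> E)" for E
    by simp
  have "compactin (product_topology (\<lambda>_::'g set. euclidean :: real topology) UNIV) K"
    unfolding K_def by (simp add: compactin_PiE)
  then have compact: "compact K"
    by (simp add: euclidean_product_topology)
  have closed: "closed (A i)" for i
    unfolding A_def fa_def
    by (cases i, simp only: prod.case)
      (intro closed_Collect_conj closed_Collect_all closed_Collect_imp closed_Collect_eq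
        closed_Collect_le continuous_intros cont open_Collect_const)
  have fip: "K \<inter> (\<Inter>i\<in>I. A i) \<noteq> {}" if I: "finite I" "I \<subseteq> ?C \<times> UNIV" for I
  proof -
    define N where "N = Max (insert 0 (snd ` I))"
    have N: "n \<le> N" if "(g, n) \<in> I" for g n
      unfolding N_def using image_eqI[of n snd "(g, n)" I] that I(1) by (intro Max_ge) auto
    have "finite (fst ` I)" "fst ` I \<subseteq> ?C" "1 / (real N + 1) > 0"
      using I by auto
    from almost[OF this] obtain \<mu> where \<mu>0: "\<forall>E\<subseteq>?C. 0 \<le> \<mu> E" "\<mu> ?C = 1"
        "\<forall>E F. E \<subseteq> ?C \<longrightarrow> F \<subseteq> ?C \<longrightarrow> E \<inter> F = {} \<longrightarrow> \<mu> (E \<union> F) = \<mu> E + \<mu> F"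
      and inv: "\<forall>g\<in>fst ` I. \<forall>E\<subseteq>?C. \<bar>\<mu> (g <#\<^bsub>G\<^esub> E) - \<mu> E\<bar> \<le> 1 / (real N + 1)"
      by (elim exE conjE)
    have \<mu>: "\<forall>E\<subseteq>?C. 0 \<le> \<mu> E" "fa \<mu>"
      unfolding fa_def using \<mu>0 by simp_all
    define \<nu> where "\<nu> E = \<mu> (E \<inter> ?C)" for E
    have \<nu>: "\<nu> E = \<mu> E" if "E \<subseteq> ?C" for E
      using that by (simp add: \<nu>_def Int_absorb2)
    have "\<mu> E \<le> 1" if "E \<subseteq> ?C" for E
    proof -
      have "\<mu> (E \<union> (?C - E)) = \<mu> E + \<mu> (?C - E)"
        using \<mu>(2) that unfolding fa_def by blast
      moreover have "E \<union> (?C - E) = ?C"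
        using that by auto
      moreover have "\<mu> (?C - E) \<ge> 0"
        using \<mu>(1) by blast
      ultimately show ?thesis
        using \<mu>(2) unfolding fa_def by simp
    qed
    then have "\<nu> \<in> K"
      using \<mu>(1) by (auto simp: K_def \<nu>_def)
    moreover have "fa \<nu>"
      using \<mu>(2) unfolding fa_def by (simp add: \<nu>)
    moreover have "\<bar>\<nu> (g <#\<^bsub>G\<^esub> E) - \<nu> E\<bar> \<le> 1 / (real n + 1)" if "(g, n) \<in> I" "E \<subseteq> ?C" for g n E
    proof -
      have g: "g \<in> fst ` I" "g \<in> ?C"
        using that I(2) by force+
      have "g <#\<^bsub>G\<^esub> E \<subseteq> ?C"
        using g(2) \<open>group G\<close> that(2) by (simp add: group.l_coset_subset_G)
      then have "\<bar>\<nu> (g <#\<^bsub>G\<^esub> E) - \<nu> E\<bar> \<le> 1 / (real N + 1)"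
        using inv[rule_format, OF g(1) that(2)] that(2) by (simp add: \<nu>)
      also have "\<dots> \<le> 1 / (real n + 1)"
        using N[OF that(1)] by (intro divide_left_mono) auto
      finally show ?thesis .
    qed
    ultimately have "\<nu> \<in> K \<inter> (\<Inter>i\<in>I. A i)"
      by (auto simp: A_def)
    then show ?thesis
      by blast
  qed
  have "K \<inter> (\<Inter>i\<in>?C \<times> UNIV. A i) \<noteq> {}"
    by (rule compact_imp_fip_image[OF compact closed fip])
  then obtain \<mu> where \<mu>: "\<mu> \<in> K" "\<And>g n. g \<in> ?C \<Longrightarrow> \<mu> \<in> A (g, n)"
    by blast
  have "\<one>\<^bsub>G\<^esub> \<in> ?C"
    using \<open>group G\<close> by (simp add: group.is_monoid monoid.one_closed)
  then have "fa \<mu>"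
    using \<mu>(2) by (auto simp: A_def)
  moreover have "\<mu> (g <#\<^bsub>G\<^esub> E) = \<mu> E" if "g \<in> ?C" "E \<subseteq> ?C" for g E
  proof -
    have "\<bar>\<mu> (g <#\<^bsub>G\<^esub> E) - \<mu> E\<bar> \<le> 1 / (real n + 1)" for n
      using \<mu>(2)[OF that(1), of n] that(2) by (simp add: A_def)
    moreover have "(\<lambda>n. 1 / (real n + 1)) \<longlonglongrightarrow> 0"
      using LIMSEQ_inverse_real_of_nat by (simp add: inverse_eq_divide add.commute)
    ultimately have "\<bar>\<mu> (g <#\<^bsub>G\<^esub> E) - \<mu> E\<bar> \<le> 0"
      by (intro LIMSEQ_le_const) auto
    then show ?thesis
      by simp
  qed
  moreover have "0 \<le> \<mu> E" for E
    using \<mu>(1) by (auto simp: K_def)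
  ultimately show ?thesis
    unfolding amenable_def fa_def using \<open>group G\<close> by (intro conjI exI[of _ \<mu>]) simp_all
qed

text \<open>Each point of an orbit stands for a coset of the stabilizer of a fixed representative.
  The mass \<open>q s\<close> is spread uniformly over a finite piece of that coset. For the
  finitely many elements of \<open>F\<close>, translation maps these pieces onto each other exactly,
  so only the variation of \<open>q\<close> contributes to the error.\<close>

lemma amenable_if_almost_invariant_action:
  fixes G :: "('g, 'm) monoid_scheme" (structure) and act :: "'g \<Rightarrow> 's \<Rightarrow> 's" and \<S> :: "'s set"
  assumes "group G"
    and act_one: "\<And>s. act \<one>\<^bsub>G\<^esub> s = s"
    and act_mult: "\<And>g h s. g \<in> carrier G \<Longrightarrow> h \<in> carrier G \<Longrightarrow> act (g \<otimes>\<^bsub>G\<^esub> h) s = act g (act h s)"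
    and stab: "\<And>s K. s \<in> \<S> \<Longrightarrow> finite K \<Longrightarrow> K \<subseteq> {g \<in> carrier G. act g s = s} \<Longrightarrow>
      \<exists>H. subgroup H G \<and> finite H \<and> K \<subseteq> H"
    and almost: "\<And>F \<epsilon>. finite F \<Longrightarrow> F \<subseteq> carrier G \<Longrightarrow> \<epsilon> > 0 \<Longrightarrow>
      \<exists>(q :: 's \<Rightarrow> real) D. finite D \<and> D \<subseteq> \<S> \<and> (\<forall>s. 0 \<le> q s) \<and> (\<forall>s. s \<notin> D \<longrightarrow> q s = 0) \<and> sum q D = 1 \<and>
        (\<forall>g\<in>F. (\<forall>s. s \<notin> D \<longrightarrow> q (act g s) = 0) \<and> (\<Sum>s\<in>D. \<bar>q (act g s) - q s\<bar>) \<le> \<epsilon>)"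
  shows "amenable G"
proof (rule amenable_if_almost_invariant[OF \<open>group G\<close>])
  interpret group G by fact
  fix F :: "'g set" and \<epsilon> :: real
  assume F: "finite F" "F \<subseteq> carrier G" and "\<epsilon> > 0"
  obtain q :: "'s \<Rightarrow> real" and D where D: "finite D" "D \<subseteq> \<S>"
    and q0: "\<forall>s. 0 \<le> q s" "\<forall>s. s \<notin> D \<longrightarrow> q s = 0" "sum q D = 1"
    and q_F: "\<forall>g\<in>F. (\<forall>s. s \<notin> D \<longrightarrow> q (act g s) = 0) \<and> (\<Sum>s\<in>D. \<bar>q (act g s) - q s\<bar>) \<le> \<epsilon>"
    using almost[OF F \<open>\<epsilon> > 0\<close>] by (elim exE conjE)
  note q = q0(1,2)[rule_format] q0(3)
  have q_act: "q (act g s) = 0" if "g \<in> F" "s \<notin> D" for g s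
    using q_F that by simp
  have q_diff: "(\<Sum>s\<in>D. \<bar>q (act g s) - q s\<bar>) \<le> \<epsilon>" if "g \<in> F" for g
    using q_F that by simp
  define orb where "orb s = {t. \<exists>g\<in>carrier G. t = act g s}" for s
  have act_inv: "act (inv g) (act g s) = s" if "g \<in> carrier G" for g s
    using act_mult[of "inv g" g s] that by (simp add: act_one)
  have orb_act: "orb (act g s) = orb s" if g: "g \<in> carrier G" for g s
  proof -
    have "act h (act g s) \<in> orb s" if "h \<in> carrier G" for h
      using that g act_mult[OF that g, of s] unfolding orb_def by (metis (mono_tags, lifting) m_closed mem_Collect_eq)
    moreover have "act h s \<in> orb (act g s)" if "h \<in> carrier G" for h
    proof -
      have "act h s = act (h \<otimes> inv g) (act g s)"
        using that g by (simp add: act_mult act_inv)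
      then show ?thesis
        using that g unfolding orb_def by blast
    qed
    ultimately show ?thesis
      unfolding orb_def by blast
  qed
  \<comment> \<open>\<S> need not be invariant, so the representative is chosen in \<S> itself,
    where stabilizers are known to be locally finite.\<close>
  define r where "r s = (SOME t. t \<in> \<S> \<inter> orb s)" for s
  define c where "c s = (SOME g. g \<in> carrier G \<and> act g (r s) = s)" for s
  have r: "r s \<in> \<S> \<inter> orb s" if "\<S> \<inter> orb s \<noteq> {}" for s
    unfolding r_def using that by (metis ex_in_conv someI_ex)
  have c: "c s \<in> carrier G \<and> act (c s) (r s) = s" if ne: "\<S> \<inter> orb s \<noteq> {}" for s
  proof -
    obtain g where "g \<in> carrier G" "r s = act g s"
      using r[OF ne] unfolding orb_def by blast
    then have "inv g \<in> carrier G \<and> act (inv g) (r s) = s"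
      by (simp add: act_inv)
    then show ?thesis
      unfolding c_def by (rule someI)
  qed
  have self: "s \<in> orb s" for s
    unfolding orb_def using act_one by (auto intro!: bexI[of _ "\<one>"])
  have meet: "\<S> \<inter> orb s \<noteq> {}" if "s \<in> D" for s
    using that D(2) self by blast
  \<comment> \<open>Schreier cocycle: the element of the stabilizer of \<open>r s\<close> by which
    \<open>g \<otimes> c s\<close> differs from the chosen coset representative of
    \<open>act g s\<close>.\<close>
  define k where "k g s = inv (c (act g s)) \<otimes> (g \<otimes> c s)" for g s
  have k: "k g s \<in> carrier G" "act (k g s) (r s) = r s" "g \<otimes> c s = c (act g s) \<otimes> k g s" "r (act g s) = r s"
    if "g \<in> F" "s \<in> D" for g s
  proof -
    have g: "g \<in> carrier G"
      using that F by auto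
    have m: "\<S> \<inter> orb (act g s) \<noteq> {}"
      using meet[OF that(2)] by (simp add: orb_act g)
    note cs = c[OF meet[OF that(2)]] and cgs = c[OF m]
    show rr: "r (act g s) = r s"
      by (simp add: r_def orb_act g)
    show "k g s \<in> carrier G"
      using cs cgs g by (simp add: k_def)
    have "act (k g s) (r s) = act (inv (c (act g s))) (act g s)"
      using cs cgs g by (simp add: k_def act_mult)
    also have "act (inv (c (act g s))) (act g s) = r s"
      using act_inv[of "c (act g s)" "r s"] cgs by (simp add: rr)
    finally show "act (k g s) (r s) = r s" .
    show "g \<otimes> c s = c (act g s) \<otimes> k g s"
      using cs cgs g by (simp add: k_def m_assoc[symmetric])
  qed
  have "\<forall>t\<in>r ` D. \<exists>H. subgroup H G \<and> finite H \<and> {k g s |g s. g \<in> F \<and> s \<in> D \<and> r s = t} \<subseteq> H"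
  proof (rule ballI, rule stab)
    fix t assume that: "t \<in> r ` D"
    show "t \<in> \<S>"
      using that r meet by blast
    have "{k g s |g s. g \<in> F \<and> s \<in> D \<and> r s = t} \<subseteq> (\<lambda>(g, s). k g s) ` (F \<times> D)"
      by auto
    then show "finite {k g s |g s. g \<in> F \<and> s \<in> D \<and> r s = t}"
      by (rule finite_subset) (use F D in auto)
    show "{k g s |g s. g \<in> F \<and> s \<in> D \<and> r s = t} \<subseteq> {g \<in> carrier G. act g t = t}"
      using k by auto
  qed
  from bchoice[OF this] obtain H where H: "\<forall>t\<in>r ` D. subgroup (H t) G \<and> finite (H t) \<and>
      {k g s |g s. g \<in> F \<and> s \<in> D \<and> r s = t} \<subseteq> H t"
    by (elim exE)
  \<comment> \<open>Uniform measure on the translate of \<open>H (r s)\<close> by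
    \<open>c s\<close>. As \<open>H (r s)\<close> contains the finitely many cocycle values that
    occur, translation by g takes it to the one at \<open>act g s\<close>.\<close>
  define m where "m s E = real (card {h \<in> H (r s). c s \<otimes> h \<in> E}) / real (card (H (r s)))" for s E
  have Hs: "subgroup (H (r s)) G" "finite (H (r s))" "card (H (r s)) > 0" if "s \<in> D" for s
    using H[rule_format, of "r s"] that subgroup.one_closed[of "H (r s)" G] by (auto simp: card_gt_0_iff)
  have m_union: "m s (E \<union> E') = m s E + m s E'" if "s \<in> D" "E \<inter> E' = {}" for s E E'
  proof -
    have "{h \<in> H (r s). c s \<otimes> h \<in> E \<union> E'} = {h \<in> H (r s). c s \<otimes> h \<in> E} \<union> {h \<in> H (r s). c s \<otimes> h \<in> E'}"
      by auto
    moreover have "card \<dots> = card {h \<in> H (r s). c s \<otimes> h \<in> E} + card {h \<in> H (r s). c s \<otimes> h \<in> E'}"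
      using that Hs[of s] by (intro card_Un_disjoint) auto
    ultimately show ?thesis
      by (simp add: m_def add_divide_distrib)
  qed
  have m_total: "m s (carrier G) = 1" if "s \<in> D" for s
  proof -
    have "{h \<in> H (r s). c s \<otimes> h \<in> carrier G} = H (r s)"
      using Hs[OF that] c[OF meet[OF that]] subgroup.subset by fastforce
    then show ?thesis
      using Hs[OF that] by (simp add: m_def card_gt_0_iff)
  qed
  have m_le_one: "m s E \<le> 1" if "s \<in> D" for s E
    using Hs[OF that] by (auto simp: m_def intro!: card_mono)
  have m_shift: "m (act g s) (g <# E) = m s E" if gs: "g \<in> F" "s \<in> D" and E: "E \<subseteq> carrier G" for g s E
  proof -
    note kk = k[OF gs] and HH = Hs[OF gs(2)] and cc = c[OF meet[OF gs(2)]]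
    have g: "g \<in> carrier G"
      using gs F by auto
    have m: "\<S> \<inter> orb (act g s) \<noteq> {}"
      using meet[OF gs(2)] by (simp add: orb_act g)
    note cgs = c[OF m]
    have kH: "k g s \<in> H (r s)"
      using H[rule_format, of "r s"] gs by blast
    have sub: "h \<in> carrier G" if "h \<in> H (r s)" for h
      using that HH(1) subgroup.subset by blast
    have *: "c (act g s) \<otimes> (k g s \<otimes> h) \<in> g <# E \<longleftrightarrow> c s \<otimes> h \<in> E" if "h \<in> H (r s)" for h
    proof -
      have "c (act g s) \<otimes> (k g s \<otimes> h) = g \<otimes> (c s \<otimes> h)"
        using kk cgs cc g sub[OF that] by (metis m_assoc)
      moreover have "g \<otimes> x \<in> g <# E \<longleftrightarrow> x \<in> E" if "x \<in> carrier G" for x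
        using that g E by (auto simp: l_coset_def)
      ultimately show ?thesis
        using cc sub[OF that] by simp
    qed
    have "{h \<in> H (r s). c (act g s) \<otimes> h \<in> g <# E} = (\<lambda>h. k g s \<otimes> h) ` {h \<in> H (r s). c s \<otimes> h \<in> E}"
    proof (intro equalityI subsetI)
      fix h assume h: "h \<in> {h \<in> H (r s). c (act g s) \<otimes> h \<in> g <# E}"
      have h': "inv (k g s) \<otimes> h \<in> H (r s)"
        using h kH HH(1) by (simp add: subgroup.m_closed subgroup.m_inv_closed)
      have eq: "k g s \<otimes> (inv (k g s) \<otimes> h) = h"
        using h kk(1) sub by (simp add: m_assoc[symmetric])
      show "h \<in> (\<lambda>h. k g s \<otimes> h) ` {h \<in> H (r s). c s \<otimes> h \<in> E}"
        using *[OF h'] h h' eq by (intro image_eqI[of _ _ "inv (k g s) \<otimes> h"]) auto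
    qed (use * kH HH(1) in \<open>auto simp: subgroup.m_closed\<close>)
    moreover have "inj_on (\<lambda>h. k g s \<otimes> h) {h \<in> H (r s). c s \<otimes> h \<in> E}"
      using kk(1) sub by (auto simp: inj_on_def)
    ultimately show ?thesis
      by (simp add: m_def kk(4) card_image)
  qed
  define \<mu> where "\<mu> E = (\<Sum>s\<in>D. q s * m s E)" for E
  have "\<bar>\<mu> (g <# E) - \<mu> E\<bar> \<le> \<epsilon>" if g: "g \<in> F" and E: "E \<subseteq> carrier G" for g E
  proof -
    have gG: "g \<in> carrier G"
      using g F by auto
    have inj: "inj_on (act g) D"
      using act_inv[OF gG] by (metis inj_onI)
    \<comment> \<open>A point of \<open>D\<close> outside the image of \<open>D\<close> has weight
      zero, because \<open>q\<close> composed with g vanishes off \<open>D\<close>; so the sum may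
      be reindexed by \<open>act g\<close>.\<close>
    have "D \<subseteq> act g ` D \<union> {t. q t = 0}"
    proof
      fix t assume "t \<in> D"
      have "act g (act (inv g) t) = t"
        using act_inv[of "inv g" t] gG by simp
      then show "t \<in> act g ` D \<union> {t. q t = 0}"
        using q_act[OF g, of "act (inv g) t"] by (cases "act (inv g) t \<in> D") (metis UnI1 imageI, auto)
    qed
    then have "\<mu> (g <# E) = (\<Sum>t\<in>act g ` D. q t * m t (g <# E))"
      unfolding \<mu>_def using D(1) q(2)
      by (intro sum.mono_neutral_cong) auto
    also have "\<dots> = (\<Sum>s\<in>D. q (act g s) * m s E)"
      using m_shift[OF g _ E] by (simp add: sum.reindex[OF inj])
    finally have "\<mu> (g <# E) - \<mu> E = (\<Sum>s\<in>D. (q (act g s) - q s) * m s E)"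
      by (simp add: \<mu>_def sum_subtractf left_diff_distrib)
    also have "\<bar>\<dots>\<bar> \<le> (\<Sum>s\<in>D. \<bar>(q (act g s) - q s) * m s E\<bar>)"
      by (rule sum_abs)
    also have "\<dots> \<le> (\<Sum>s\<in>D. \<bar>q (act g s) - q s\<bar>)"
    proof (rule sum_mono)
      fix s assume "s \<in> D"
      then have "0 \<le> m s E" "m s E \<le> 1"
        using m_le_one by (auto simp: m_def)
      then show "\<bar>(q (act g s) - q s) * m s E\<bar> \<le> \<bar>q (act g s) - q s\<bar>"
        by (simp add: abs_mult mult_left_le)
    qed
    also have "\<dots> \<le> \<epsilon>"
      by (rule q_diff[OF g])
    finally show ?thesis .
  qed
  moreover have "0 \<le> \<mu> E" for E
    unfolding \<mu>_def using q(1) by (intro sum_nonneg) (auto simp: m_def)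
  moreover have "\<mu> (carrier G) = 1"
    by (simp add: \<mu>_def m_total q(3))
  moreover have "\<mu> (E \<union> E') = \<mu> E + \<mu> E'" if "E \<inter> E' = {}" for E E'
    by (simp add: \<mu>_def m_union that distrib_left sum.distrib)
  ultimately show "\<exists>\<mu> :: 'g set \<Rightarrow> real.
        (\<forall>E\<subseteq>carrier G. 0 \<le> \<mu> E) \<and> \<mu> (carrier G) = 1 \<and>
        (\<forall>E F. E \<subseteq> carrier G \<longrightarrow> F \<subseteq> carrier G \<longrightarrow> E \<inter> F = {} \<longrightarrow> \<mu> (E \<union> F) = \<mu> E + \<mu> F) \<and>
        (\<forall>g\<in>F. \<forall>E\<subseteq>carrier G. \<bar>\<mu> (g <# E) - \<mu> E\<bar> \<le> \<epsilon>)"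
    by (intro exI[of _ \<mu>]) simp
qed

section \<open>Recurrent actions of bounded displacement on the integers\<close>

definition half_lines :: "int set set" where
  "half_lines = {S. \<exists>M. \<forall>j. (j < - M \<longrightarrow> j \<notin> S) \<and> (j > M \<longrightarrow> j \<in> S)}"

text \<open>Configurations on \<open>W\<close> are summed site by site. Norms and inner products of
  product vectors thereby become products over \<open>W\<close>.\<close>

lemma sum_Pow_prod_if:
  fixes f g :: "'i \<Rightarrow> 'c :: comm_semiring_1"
  assumes "finite W"
  shows "(\<Sum>X\<in>Pow W. \<Prod>j\<in>W. if j \<in> X then f j else g j) = (\<Prod>j\<in>W. f j + g j)"
proof -
  have "(\<Prod>j\<in>W. if j \<in> X then f j else g j) = (\<Prod>j\<in>X. f j) * (\<Prod>j\<in>W - X. g j)" if "X \<in> Pow W" for X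
  proof -
    have "W \<inter> X = X" "W \<inter> - X = W - X"
      using that by auto
    then show ?thesis
      using assms by (simp add: prod.If_cases)
  qed
  then show ?thesis
    using assms by (simp add: prod_add)
qed

lemma cos_ge_one_minus_half_square: "1 - x\<^sup>2 / 2 \<le> cos (x::real)"
proof -
  have "(sin (x / 2))\<^sup>2 \<le> (x / 2)\<^sup>2"
    using abs_sin_x_le_abs_x[of "x / 2"] by (simp only: abs_le_square_iff)
  then show ?thesis
    using cos_double_sin[of "x / 2"] by (simp add: power_divide)
qed

text \<open>The square root of \<open>q\<close> is a product vector with coordinates \<open>sin (\<theta> j)\<close> and \<open>cos (\<theta> j)\<close>,
  where \<open>\<theta>\<close> climbs linearly from \<open>0\<close> to \<open>\<pi> / 2\<close> over \<open>{-M..M}\<close>. Its inner product with the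
  translate by \<open>\<sigma>\<close> is the product of the \<open>cos (\<theta> (\<sigma> i) - \<theta> i)\<close>, that is \<open>O(M)\<close> factors of size
  \<open>1 - O(1 / M\<^sup>2)\<close>.\<close>

lemma almost_invariant_on_half_lines:
  fixes C :: int and \<epsilon> :: real
  assumes "0 \<le> C" "0 < \<epsilon>"
  shows "\<exists>(q :: int set \<Rightarrow> real) D. finite D \<and> D \<subseteq> half_lines \<and>
    (\<forall>S. 0 \<le> q S) \<and> (\<forall>S. S \<notin> D \<longrightarrow> q S = 0) \<and> sum q D = 1 \<and>
    (\<forall>\<sigma>. bij \<sigma> \<and> (\<forall>j. \<bar>\<sigma> j - j\<bar> \<le> C) \<longrightarrow>
      (\<forall>S. S \<notin> D \<longrightarrow> q (\<sigma> ` S) = 0) \<and> (\<Sum>S\<in>D. \<bar>q (\<sigma> ` S) - q S\<bar>) \<le> \<epsilon>)"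
proof -
  \<comment> \<open>The final estimate bounds \<open>8 * (1 - I)\<close> by
    \<open>8 * (5 * M) * ((C / M)\<^sup>2 / 2)\<close>, that is \<open>20 * C\<^sup>2 / M\<close>,
    which has to be at most \<open>\<epsilon>\<^sup>2\<close>. The bound \<open>C \<le> M\<close>
    keeps the size of the window \<open>W\<close> below \<open>5 * M\<close>.\<close>
  obtain M0 :: nat where M0: "20 * (real_of_int C)\<^sup>2 / \<epsilon>\<^sup>2 \<le> real M0"
    using real_arch_simple by blast
  define M :: int where "M = max 1 (max C (int M0))"
  have M: "1 \<le> M" "C \<le> M" "20 * (real_of_int C)\<^sup>2 / \<epsilon>\<^sup>2 \<le> real_of_int M"
    using M0 by (auto simp: M_def)
  define \<theta> :: "int \<Rightarrow> real" where "\<theta> j = pi / 4 * (1 + max (-1) (min 1 (real_of_int j / real_of_int M)))" for j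
  have \<theta>_low: "\<theta> j = 0" if "j \<le> - M" for j
  proof -
    have "real_of_int j / real_of_int M \<le> -1"
      using that M(1) by (simp add: divide_le_eq)
    then show ?thesis by (simp add: \<theta>_def)
  qed
  have \<theta>_high: "\<theta> j = pi / 2" if "j \<ge> M" for j
  proof -
    have "real_of_int j / real_of_int M \<ge> 1"
      using that M(1) by (simp add: le_divide_eq)
    then show ?thesis by (simp add: \<theta>_def)
  qed
  have \<theta>_lip: "\<bar>\<theta> i - \<theta> j\<bar> \<le> pi / 4 * (real_of_int C / real_of_int M)" if "\<bar>i - j\<bar> \<le> C" for i j
  proof -
    let ?x = "real_of_int i / real_of_int M" and ?y = "real_of_int j / real_of_int M"
    have "\<bar>max (-1) (min 1 x) - max (-1) (min 1 y)\<bar> \<le> \<bar>x - y\<bar>" for x y :: real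
      by linarith
    then have "\<bar>max (-1) (min 1 ?x) - max (-1) (min 1 ?y)\<bar> \<le> \<bar>?x - ?y\<bar>" .
    also have "\<bar>?x - ?y\<bar> = \<bar>real_of_int (i - j)\<bar> / real_of_int M"
      using M(1) by (simp add: diff_divide_distrib[symmetric])
    also have "\<dots> \<le> real_of_int C / real_of_int M"
      using that M(1) by (intro divide_right_mono) linarith+
    finally have "pi / 4 * \<bar>max (-1) (min 1 ?x) - max (-1) (min 1 ?y)\<bar> \<le> pi / 4 * (real_of_int C / real_of_int M)"
      by (intro mult_left_mono) auto
    moreover have "\<theta> i - \<theta> j = pi / 4 * (max (-1) (min 1 ?x) - max (-1) (min 1 ?y))"
      by (simp add: \<theta>_def algebra_simps)
    ultimately show ?thesis
      by (simp only: abs_mult) simp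
  qed
  \<comment> \<open>From distance M on, sites are frozen, with factor 0 or 1. A permutation of
    displacement at most C sends sites beyond M + C to frozen ones and moves sets of
    \<open>D\<close> into \<open>D2\<close>; hence the two nested windows.\<close>
  define W where "W = {- M - C..M + C}"
  define V where "V = {- M - 2 * C..M + 2 * C}"
  define D where "D = {S :: int set. (\<forall>j < - M - C. j \<notin> S) \<and> (\<forall>j > M + C. j \<in> S)}"
  define D2 where "D2 = {S :: int set. (\<forall>j < - M - 2 * C. j \<notin> S) \<and> (\<forall>j > M + 2 * C. j \<in> S)}"
  define f where "f S = (if S \<in> D2 then \<Prod>j\<in>V. if j \<in> S then sin (\<theta> j) else cos (\<theta> j) else 0)" for S
  have fin: "finite W" "finite V"
    by (auto simp: W_def V_def)
  have f_image: "f (\<sigma> ` S) = (\<Prod>i\<in>W. if i \<in> S then sin (\<theta> (\<sigma> i)) else cos (\<theta> (\<sigma> i)))"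
    if \<sigma>: "bij \<sigma>" "\<And>j. \<bar>\<sigma> j - j\<bar> \<le> C" and S: "S \<in> D" for \<sigma> S
  proof -
    have bnd: "\<sigma> j \<le> j + C" "j - C \<le> \<sigma> j" for j
      using \<sigma>(2)[of j] by linarith+
    have mem: "\<sigma> i \<in> \<sigma> ` S \<longleftrightarrow> i \<in> S" for i
      using \<sigma>(1) by (simp add: bij_is_inj inj_image_mem_iff)
    have D2: "\<sigma> ` S \<in> D2"
    proof -
      have "j \<notin> \<sigma> ` S" if "j < - M - 2 * C" for j
      proof
        assume "j \<in> \<sigma> ` S"
        then obtain i where "i \<in> S" "j = \<sigma> i" by blast
        then show False
          using S bnd(2)[of i] that by (force simp: D_def)
      qed
      moreover have "j \<in> \<sigma> ` S" if "j > M + 2 * C" for j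
      proof -
        obtain i where i: "j = \<sigma> i"
          using \<sigma>(1) by (metis bij_pointE)
        then have "i > M + C"
          using that bnd(1)[of i] by linarith
        then show ?thesis
          using S i by (auto simp: D_def)
      qed
      ultimately show ?thesis
        by (simp add: D2_def)
    qed
    have bijV: "bij_betw \<sigma> (\<sigma> -` V) V"
      using \<sigma>(1) by (metis bij_betw_subset bij_is_surj subset_UNIV surj_image_vimage_eq)
    have "f (\<sigma> ` S) = (\<Prod>j\<in>V. if j \<in> \<sigma> ` S then sin (\<theta> j) else cos (\<theta> j))"
      using D2 by (simp add: f_def)
    also have "\<dots> = (\<Prod>i\<in>\<sigma> -` V. if i \<in> S then sin (\<theta> (\<sigma> i)) else cos (\<theta> (\<sigma> i)))"
      using prod.reindex_bij_betw[OF bijV, of "\<lambda>j. if j \<in> \<sigma> ` S then sin (\<theta> j) else cos (\<theta> j)"]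
      by (simp add: mem)
    also have "\<dots> = (\<Prod>i\<in>W. if i \<in> S then sin (\<theta> (\<sigma> i)) else cos (\<theta> (\<sigma> i)))"
    proof (rule prod.mono_neutral_right)
      show "finite (\<sigma> -` V)"
        using fin(2) \<sigma>(1) by (simp add: bij_is_inj finite_vimageI)
      show "W \<subseteq> \<sigma> -` V"
      proof
        fix i assume "i \<in> W"
        then show "i \<in> \<sigma> -` V"
          using bnd[of i] by (simp add: W_def V_def)
      qed
      show "\<forall>i\<in>\<sigma> -` V - W. (if i \<in> S then sin (\<theta> (\<sigma> i)) else cos (\<theta> (\<sigma> i))) = 1"
      proof
        fix i assume "i \<in> \<sigma> -` V - W"
        then consider "i < - M - C" | "i > M + C"
          by (force simp: W_def)
        then show "(if i \<in> S then sin (\<theta> (\<sigma> i)) else cos (\<theta> (\<sigma> i))) = 1"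
        proof cases
          case 1
          then have "\<sigma> i \<le> - M"
            using bnd(1)[of i] by linarith
          then show ?thesis
            using 1 S by (simp add: D_def \<theta>_low)
        next
          case 2
          then have "\<sigma> i \<ge> M"
            using bnd(2)[of i] by linarith
          then show ?thesis
            using 2 S by (simp add: D_def \<theta>_high)
        qed
      qed
    qed
    finally show ?thesis .
  qed
  have f_image_zero: "f (\<sigma> ` S) = 0" if \<sigma>: "bij \<sigma>" "\<And>j. \<bar>\<sigma> j - j\<bar> \<le> C" and S: "S \<notin> D" for \<sigma> S
  proof (cases "\<sigma> ` S \<in> D2")
    case True
    have bnd: "\<sigma> j \<le> j + C" "j - C \<le> \<sigma> j" for j
      using \<sigma>(2)[of j] by linarith+
    have mem: "\<sigma> i \<in> \<sigma> ` S \<longleftrightarrow> i \<in> S" for i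
      using \<sigma>(1) by (simp add: bij_is_inj inj_image_mem_iff)
    \<comment> \<open>A site that keeps S out of \<open>D\<close> is sent to a frozen site and has
      the wrong occupation there, so one factor vanishes.\<close>
    have "\<exists>j\<in>V. (if j \<in> \<sigma> ` S then sin (\<theta> j) else cos (\<theta> j)) = 0"
    proof -
      consider i where "i < - M - C" "i \<in> S" | i where "i > M + C" "i \<notin> S"
        using S by (auto simp: D_def)
      then show ?thesis
      proof cases
        case 1
        then have "\<sigma> i \<le> - M" "\<not> \<sigma> i < - M - 2 * C"
          using bnd(1)[of i] True mem[of i] unfolding D2_def by auto
        then show ?thesis
          using 1 M(1) assms(1) by (intro bexI[of _ "\<sigma> i"]) (auto simp: V_def \<theta>_low)
      next
        case 2
        then have "\<sigma> i \<ge> M" "\<not> \<sigma> i > M + 2 * C"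
          using bnd(2)[of i] True mem[of i] unfolding D2_def by auto
        then show ?thesis
          using 2 M(1) assms(1) by (intro bexI[of _ "\<sigma> i"]) (auto simp: V_def \<theta>_high mem)
      qed
    qed
    then show ?thesis
      using True fin(2) by (simp add: f_def)
  qed (simp add: f_def)
  have f_eq: "f S = (\<Prod>i\<in>W. if i \<in> S then sin (\<theta> i) else cos (\<theta> i))" if "S \<in> D" for S
    using f_image[of id S] that assms(1) by (simp cong: if_cong)
  have bijD: "bij_betw (\<lambda>X. X \<union> {M + C<..}) (Pow W) D"
    by (rule bij_betwI[where g = "\<lambda>S. S \<inter> W"]) (use assms(1) M(1) in \<open>force simp: W_def D_def\<close>)+
  have sum_D: "(\<Sum>S\<in>D. \<Prod>j\<in>W. if j \<in> S then g j else h j) = (\<Prod>j\<in>W. g j + h j)" for g h :: "int \<Rightarrow> real"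
  proof -
    have "(\<Sum>S\<in>D. \<Prod>j\<in>W. if j \<in> S then g j else h j) =
        (\<Sum>X\<in>Pow W. \<Prod>j\<in>W. if j \<in> X \<union> {M + C<..} then g j else h j)"
      by (rule sum.reindex_bij_betw[OF bijD, symmetric])
    also have "\<dots> = (\<Sum>X\<in>Pow W. \<Prod>j\<in>W. if j \<in> X then g j else h j)"
      by (intro sum.cong prod.cong) (auto simp: W_def)
    finally show ?thesis
      using fin(1) by (simp add: sum_Pow_prod_if)
  qed
  have finD: "finite D"
    using bij_betw_finite[OF bijD] fin(1) by simp
  have if_mult: "(if P then x else y) * (if P then x' else y') = (if P then x * x' else y * y')"
    for P and x y x' y' :: real
    by simp
  have norm_image: "(\<Sum>S\<in>D. (f (\<sigma> ` S))\<^sup>2) = 1" if "bij \<sigma>" "\<And>j. \<bar>\<sigma> j - j\<bar> \<le> C" for \<sigma>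
    using f_image[OF that]
    by (simp add: power2_eq_square prod.distrib[symmetric] if_mult sum_D
        sin_squared_eq[unfolded power2_eq_square])
  have norm: "(\<Sum>S\<in>D. (f S)\<^sup>2) = 1"
    using norm_image[of id] assms(1) by simp
  have inner: "(\<Sum>S\<in>D. f (\<sigma> ` S) * f S) = (\<Prod>i\<in>W. cos (\<theta> (\<sigma> i) - \<theta> i))"
    if "bij \<sigma>" "\<And>j. \<bar>\<sigma> j - j\<bar> \<le> C" for \<sigma>
    using f_image[OF that] f_eq
    by (simp add: prod.distrib[symmetric] if_mult sum_D cos_diff add.commute)
  have diff: "(\<Sum>S\<in>D. \<bar>(f (\<sigma> ` S))\<^sup>2 - (f S)\<^sup>2\<bar>) \<le> \<epsilon>"
    if \<sigma>: "bij \<sigma>" "\<And>j. \<bar>\<sigma> j - j\<bar> \<le> C" for \<sigma>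
  proof -
    define I where "I = (\<Sum>S\<in>D. f (\<sigma> ` S) * f S)"
    define y where "y = pi / 4 * (real_of_int C / real_of_int M)"
    define x where "x = y\<^sup>2 / 2"
    have C_M: "0 \<le> real_of_int C / real_of_int M" "real_of_int C / real_of_int M \<le> 1"
      using assms(1) M(1,2) by auto
    have p: "0 \<le> pi / 4" "pi / 4 \<le> 1"
      using pi_less_4 pi_ge_zero by simp_all
    have y: "0 \<le> y" "y \<le> real_of_int C / real_of_int M"
      unfolding y_def using mult_nonneg_nonneg[OF p(1) C_M(1)] mult_right_mono[OF p(2) C_M(1)] by simp_all
    have x: "0 \<le> x" "x \<le> 1" "x \<le> (real_of_int C / real_of_int M)\<^sup>2 / 2"
      using power_mono[OF y(2,1), of 2] power_le_one[OF C_M, of 2] by (auto simp: x_def)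
    have "1 - real (card W) * x \<le> (1 - x) ^ card W"
      using Bernoulli_inequality[of "- x" "card W"] x by simp
    also have "\<dots> = (\<Prod>i\<in>W. 1 - x)"
      by simp
    also have "\<dots> \<le> (\<Prod>i\<in>W. cos (\<theta> (\<sigma> i) - \<theta> i))"
    proof (rule prod_mono, intro conjI)
      fix i
      have "\<bar>\<theta> (\<sigma> i) - \<theta> i\<bar> \<le> \<bar>y\<bar>"
        using \<theta>_lip[OF \<sigma>(2)[of i]] y(1) unfolding y_def by linarith
      then have "(\<theta> (\<sigma> i) - \<theta> i)\<^sup>2 \<le> y\<^sup>2"
        by (simp only: abs_le_square_iff)
      moreover have "1 - (\<theta> (\<sigma> i) - \<theta> i)\<^sup>2 / 2 \<le> cos (\<theta> (\<sigma> i) - \<theta> i)"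
        by (rule cos_ge_one_minus_half_square)
      ultimately show "1 - x \<le> cos (\<theta> (\<sigma> i) - \<theta> i)"
        by (simp add: x_def)
    qed (use x in auto)
    finally have "1 - I \<le> real (card W) * x"
      using inner[OF \<sigma>] by (simp add: I_def)
    also have "\<dots> \<le> (5 * real_of_int M) * ((real_of_int C / real_of_int M)\<^sup>2 / 2)"
    proof (rule mult_mono)
      show "real (card W) \<le> 5 * real_of_int M"
        using M(1,2) assms(1) by (simp add: W_def)
    qed (use x M in auto)
    also have "\<dots> = 5 / 2 * (real_of_int C)\<^sup>2 / real_of_int M"
      using M(1) by (simp add: power2_eq_square field_simps)
    finally have I: "8 * (1 - I) \<le> 20 * (real_of_int C)\<^sup>2 / real_of_int M"
      by simp
    also have "\<dots> \<le> \<epsilon>\<^sup>2"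
      using M(1,3) assms(2) by (simp add: field_simps)
    finally have I: "8 * (1 - I) \<le> \<epsilon>\<^sup>2" .
    \<comment> \<open>Cauchy-Schwarz applied to |u^2 - v^2| = |u - v| |u + v| for unit vectors u, v
      with inner product I. The product \<open>(2 - 2 * I) * (2 + 2 * I)\<close> falls short of
      \<open>8 * (1 - I)\<close> by \<open>4 * (1 - I)\<^sup>2\<close>.\<close>
    have "(\<Sum>S\<in>D. \<bar>(f (\<sigma> ` S))\<^sup>2 - (f S)\<^sup>2\<bar>)\<^sup>2 =
        (\<Sum>S\<in>D. \<bar>f (\<sigma> ` S) - f S\<bar> * \<bar>f (\<sigma> ` S) + f S\<bar>)\<^sup>2"
      by (simp add: abs_mult[symmetric] power2_eq_square algebra_simps)
    also have "\<dots> \<le> (\<Sum>S\<in>D. \<bar>f (\<sigma> ` S) - f S\<bar>\<^sup>2) * (\<Sum>S\<in>D. \<bar>f (\<sigma> ` S) + f S\<bar>\<^sup>2)"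
      by (rule Cauchy_Schwarz_ineq_sum)
    also have "(\<Sum>S\<in>D. \<bar>f (\<sigma> ` S) - f S\<bar>\<^sup>2) = 2 - 2 * I"
      using norm norm_image[OF \<sigma>]
      by (simp add: power2_diff sum.distrib sum_subtractf I_def sum_distrib_left mult.assoc)
    also have "(\<Sum>S\<in>D. \<bar>f (\<sigma> ` S) + f S\<bar>\<^sup>2) = 2 + 2 * I"
      using norm norm_image[OF \<sigma>]
      by (simp add: power2_sum sum.distrib I_def sum_distrib_left mult.assoc)
    also have "(2 - 2 * I) * (2 + 2 * I) \<le> 8 * (1 - I)"
      using zero_le_square[of "1 - I"] by (simp add: algebra_simps)
    also have "\<dots> \<le> \<epsilon>\<^sup>2"
      by (rule I)
    finally show ?thesis
      using assms(2) by (simp add: power2_le_iff_abs_le)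
  qed
  show ?thesis
  proof (intro exI[of _ "\<lambda>S. (f S)\<^sup>2"] exI[of _ D] conjI allI impI)
    show "D \<subseteq> half_lines"
      unfolding D_def half_lines_def by (force intro!: exI[of _ "M + C"])
    show "(f S)\<^sup>2 = 0" if "S \<notin> D" for S
      using f_image_zero[of id S] that assms(1) by simp
    show "(\<Sum>S\<in>D. (f S)\<^sup>2) = 1"
      by (rule norm)
    show "finite D"
      by (rule finD)
  qed (use f_image_zero diff in auto)
qed

text \<open>\<open>d\<close> is the displacement cocycle of an action on the integers. Recurrence is
  asked only for the pattern around 0, since a window there contains the irregular part of a
  half-line. The gap \<open>L\<close> may depend on \<open>F\<close> and \<open>R\<close>, but as
  \<open>i\<close> runs over all integers, returns occur in both directions.\<close>

locale recurrent_displacement = group G for G (structure) +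
  fixes d :: "'a \<Rightarrow> int \<Rightarrow> int"
  assumes d_one: "d \<one> k = 0"
    and d_mult: "\<lbrakk>g \<in> carrier G; h \<in> carrier G\<rbrakk> \<Longrightarrow> d (g \<otimes> h) k = d h k + d g (k + d h k)"
    and faithful: "\<lbrakk>g \<in> carrier G; \<And>k. d g k = 0\<rbrakk> \<Longrightarrow> g = \<one>"
    and bounded: "g \<in> carrier G \<Longrightarrow> \<exists>C. \<forall>k. \<bar>d g k\<bar> \<le> C"
    and recurrent: "\<lbrakk>finite F; F \<subseteq> carrier G\<rbrakk> \<Longrightarrow>
      \<exists>L. \<forall>i. \<exists>t. i \<le> t \<and> t \<le> i + L \<and> (\<forall>g\<in>F. \<forall>j. \<bar>j\<bar> \<le> R \<longrightarrow> d g (t + j) = d g j)"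
begin

definition move :: "'a \<Rightarrow> int \<Rightarrow> int" where
  "move g k = k + d g k"

lemma move_one: "move \<one> k = k"
  by (simp add: move_def d_one)

lemma move_mult: "\<lbrakk>g \<in> carrier G; h \<in> carrier G\<rbrakk> \<Longrightarrow> move (g \<otimes> h) k = move g (move h k)"
  by (simp add: move_def d_mult)

lemma bij_move: "g \<in> carrier G \<Longrightarrow> bij (move g)"
  by (rule o_bij[of "move (inv g)"]) (auto simp: fun_eq_iff move_mult[symmetric] move_one)

lemma uniformly_bounded:
  assumes "finite F" "F \<subseteq> carrier G"
  obtains C where "0 \<le> C" "\<And>g k. g \<in> F \<Longrightarrow> \<bar>d g k\<bar> \<le> C"
proof -
  have "\<forall>g\<in>F. \<exists>C. \<forall>k. \<bar>d g k\<bar> \<le> C"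
    using bounded assms(2) by blast
  from bchoice[OF this] obtain c where c: "\<forall>g\<in>F. \<forall>k. \<bar>d g k\<bar> \<le> c g"
    by (elim exE)
  show thesis
  proof (rule that[of "Max (insert 0 (c ` F))"])
    show "0 \<le> Max (insert 0 (c ` F))"
      using assms(1) by simp
    fix g k assume "g \<in> F"
    then have "c g \<le> Max (insert 0 (c ` F))"
      using assms(1) by simp
    then show "\<bar>d g k\<bar> \<le> Max (insert 0 (c ` F))"
      using c \<open>g \<in> F\<close> by (meson order_trans)
  qed
qed

text \<open>Recurrence produces translates of \<open>S\<close>, with bounded gaps, all invariant under the generated group.
  They confine its displacements to a fixed bound \<open>B\<close>, so an element is determined by how the
  generators act on the finitely many patterns of a window of radius \<open>B\<close>.\<close>

lemma finite_generate_stabilizer: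
  assumes S: "S \<in> half_lines" and K: "finite K" "K \<subseteq> {g \<in> carrier G. move g ` S = S}"
  shows "finite (generate G K)"
proof -
  have KG: "K \<subseteq> carrier G"
    using K by auto
  define F where "F = K \<union> (\<lambda>g. inv g) ` K"
  have F: "finite F" "F \<subseteq> carrier G"
    using K by (auto simp: F_def)
  have F_S: "move g i \<in> S \<longleftrightarrow> i \<in> S" if "g \<in> F" for g i
  proof -
    have K_S: "move g i \<in> S \<longleftrightarrow> i \<in> S" if "g \<in> K" for g i
    proof -
      have "move g i \<in> move g ` S \<longleftrightarrow> i \<in> S"
        using bij_move[of g] that KG by (intro inj_image_mem_iff) (auto simp: bij_is_inj)
      then show ?thesis
        using that K by auto
    qed
    show ?thesis
    proof (cases "g \<in> K")
      case False
      then obtain h where h: "h \<in> K" "g = inv h"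
        using \<open>g \<in> F\<close> by (auto simp: F_def)
      then show ?thesis
        using K_S[OF h(1), of "move g i"] move_mult[of h g i] KG by (auto simp: move_one)
    qed (use K_S in auto)
  qed
  obtain C where C: "0 \<le> C" "\<And>g k. g \<in> F \<Longrightarrow> \<bar>d g k\<bar> \<le> C"
    using uniformly_bounded[OF F] by blast
  obtain M where M: "\<And>j. j < - M \<Longrightarrow> j \<notin> S" "\<And>j. j > M \<Longrightarrow> j \<in> S"
    using S unfolding half_lines_def by blast
  \<comment> \<open>S is settled beyond M and a generator moves a point by at most C, so the
    displacements within radius M + C decide how a generator acts near the cut.\<close>
  obtain L where L: "\<And>i. \<exists>t. i \<le> t \<and> t \<le> i + L \<and> (\<forall>g\<in>F. \<forall>j. \<bar>j\<bar> \<le> M + C \<longrightarrow> d g (t + j) = d g j)"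
    using recurrent[OF F, of "M + C"] by blast
  define returns where "returns = {t. \<forall>g\<in>F. \<forall>j. \<bar>j\<bar> \<le> M + C \<longrightarrow> d g (t + j) = d g j}"
  let ?H = "generate G K"
  have HG: "?H \<subseteq> carrier G"
    using KG by (rule generate_incl)
  have F_shift: "move g i - t \<in> S \<longleftrightarrow> i - t \<in> S" if g: "g \<in> F" and t: "t \<in> returns" for g i t
  proof (cases "\<bar>i - t\<bar> \<le> M + C")
    case True
    then have "d g (t + (i - t)) = d g (i - t)"
      using t g unfolding returns_def by blast
    then have "move g i - t = move g (i - t)"
      by (simp add: move_def)
    then show ?thesis
      using F_S[OF g] by simp
  next
    case False
    then consider "i - t > M + C" | "i - t < - (M + C)"
      by linarith
    then show ?thesis
    proof cases
      case 1
      then have "move g i - t > M" "i - t > M"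
        using C(1) C(2)[OF g, of i] by (auto simp: move_def)
      then show ?thesis
        using M(2) by blast
    next
      case 2
      then have "move g i - t < - M" "i - t < - M"
        using C(1) C(2)[OF g, of i] by (auto simp: move_def)
      then show ?thesis
        using M(1) by blast
    qed
  qed
  have H_shift: "move h i - t \<in> S \<longleftrightarrow> i - t \<in> S" if "h \<in> ?H" "t \<in> returns" for h i t
    using that(1)
  proof (induction h arbitrary: i rule: generate.induct)
    case one
    then show ?case by (simp add: move_one)
  next
    case (incl h)
    then show ?case using F_shift[OF _ that(2)] by (simp add: F_def)
  next
    case (inv h)
    then show ?case using F_shift[OF _ that(2)] by (simp add: F_def)
  next
    case (eng h1 h2)
    then have "h1 \<in> carrier G" "h2 \<in> carrier G"
      using HG by auto
    then show ?case
      using eng.IH by (simp add: move_mult)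
  qed
  \<comment> \<open>From any i there is a return t with \<open>i - t\<close> between M + 1 and M + 1
    + L. Then i lies in the copy of S at t; so does its image, which is therefore at least t - M. A
    copy whose irregular part lies to the right of i gives the other bound.\<close>
  define B where "B = 2 * M + 1 + L"
  have H_bound: "\<bar>d h i\<bar> \<le> B" if h: "h \<in> ?H" for h i
  proof -
    obtain t where t: "t \<in> returns" "i - M - 1 - L \<le> t" "t \<le> i - M - 1"
      using L[of "i - M - 1 - L"] unfolding returns_def by auto
    have "i - t \<in> S"
      using t by (intro M(2)) simp
    then have "move h i - t \<in> S"
      using H_shift[OF h t(1)] by simp
    then have "\<not> move h i - t < - M"
      using M(1) by blast
    obtain t' where t': "t' \<in> returns" "i + M + 1 \<le> t'" "t' \<le> i + M + 1 + L"
      using L[of "i + M + 1"] unfolding returns_def by auto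
    have "i - t' \<notin> S"
      using t' by (intro M(1)) simp
    then have "move h i - t' \<notin> S"
      using H_shift[OF h t'(1)] by simp
    then have "\<not> move h i - t' > M"
      using M(2) by blast
    then show ?thesis
      using \<open>\<not> move h i - t < - M\<close> t t' by (simp add: move_def B_def)
  qed
  define P where "P i = (\<lambda>(g, j)\<in>F \<times> {-B..B}. d g (i + j))" for i
  have "range P \<subseteq> (F \<times> {-B..B}) \<rightarrow>\<^sub>E {-C..C}"
    using C(2) by (force simp: P_def abs_le_iff)
  then have fin_P: "finite (range P)"
    by (rule finite_subset) (simp add: finite_PiE F(1))
  have P_eq: "d g (i + j) = d g (i' + j)" if "P i = P i'" "g \<in> F" "\<bar>j\<bar> \<le> B" for g i i' j
    using fun_cong[OF that(1), of "(g, j)"] that(2,3) by (auto simp: P_def abs_le_iff)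
  \<comment> \<open>A word acts from its right end, so the part \<open>h0\<close> already applied is
    carried along: the point reached is still within B of i, and the next generator acts there as
    \<open>P i\<close> prescribes.\<close>
  have step: "d (h \<otimes> h0) i = d (h \<otimes> h0) i'"
    if "h \<in> ?H" "h0 \<in> ?H" "P i = P i'" "d h0 i = d h0 i'" for h h0 i i'
    using that
  proof (induction h arbitrary: h0 rule: generate.induct)
    case one
    then show ?case using HG by auto
  next
    case (incl h)
    then have "d h (i + d h0 i) = d h (i' + d h0 i)"
      by (intro P_eq H_bound) (auto simp: F_def)
    then show ?case
      using incl HG KG by (subst (1 2) d_mult) auto
  next
    case (inv h)
    then have "d (inv h) (i + d h0 i) = d (inv h) (i' + d h0 i)"
      by (intro P_eq H_bound) (auto simp: F_def)
    then show ?case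
      using inv HG KG by (subst (1 2) d_mult) auto
  next
    case (eng h1 h2)
    have "h2 \<otimes> h0 \<in> ?H"
      using eng by (blast intro: generate.eng)
    then have "d (h1 \<otimes> (h2 \<otimes> h0)) i = d (h1 \<otimes> (h2 \<otimes> h0)) i'"
      using eng by blast
    moreover have "h1 \<otimes> h2 \<otimes> h0 = h1 \<otimes> (h2 \<otimes> h0)"
      using eng HG by (intro m_assoc) auto
    ultimately show ?case
      by simp
  qed
  have determined: "d h i = d h i'" if "h \<in> ?H" "P i = P i'" for h i i'
    using step[OF that(1) generate.one that(2)] that(1) HG by (auto simp: d_one)
  define rep where "rep p = (SOME i. P i = p)" for p
  have rep: "P (rep (P i)) = P i" for i
    unfolding rep_def by (rule someI[of "\<lambda>i'. P i' = P i" i]) simp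
  define \<Psi> where "\<Psi> h = (\<lambda>p\<in>range P. d h (rep p))" for h
  have "\<Psi> ` ?H \<subseteq> range P \<rightarrow>\<^sub>E {-B..B}"
  proof -
    have "d h (rep p) \<in> {-B..B}" if "h \<in> ?H" for h p
      using H_bound[OF that, of "rep p"] by (simp add: abs_le_iff)
    then show ?thesis
      by (auto simp: \<Psi>_def)
  qed
  then have "finite (\<Psi> ` ?H)"
    by (rule finite_subset) (simp add: finite_PiE fin_P)
  moreover have "inj_on \<Psi> ?H"
  proof
    fix h h' assume h: "h \<in> ?H" "h' \<in> ?H" "\<Psi> h = \<Psi> h'"
    have G: "h \<in> carrier G" "h' \<in> carrier G"
      using h HG by auto
    have "d h i = d h' i" for i
    proof -
      have "d h (rep (P i)) = d h' (rep (P i))"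
        using fun_cong[OF h(3), of "P i"] by (simp add: \<Psi>_def)
      then show ?thesis
        using determined[OF _ rep] h(1,2) by metis
    qed
    then have "d (inv h \<otimes> h') k = d (inv h \<otimes> h) k" for k
      using G by (simp only: d_mult inv_closed)
    then have "inv h \<otimes> h' = \<one>"
      using G by (intro faithful) (simp_all add: d_one)
    then show "h = h'"
      using G by (metis inv_equality inv_inv inv_closed)
  qed
  ultimately show ?thesis
    by (rule finite_imageD)
qed

theorem amenable: "amenable G"
proof (rule amenable_if_almost_invariant_action[where act = "\<lambda>g S. move g ` S" and \<S> = half_lines])
  show "group G"
    by (rule is_group)
  show "move \<one> ` S = S" for S
    by (simp add: move_one)
  show "move (g \<otimes> h) ` S = move g ` move h ` S" if "g \<in> carrier G" "h \<in> carrier G" for g h S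
    using that by (simp add: move_mult image_image)
  show "\<exists>H. subgroup H G \<and> finite H \<and> K \<subseteq> H"
    if "S \<in> half_lines" "finite K" "K \<subseteq> {g \<in> carrier G. move g ` S = S}" for S K
    using that finite_generate_stabilizer[OF that] generate_is_subgroup[of K]
    by (intro exI[of _ "generate G K"]) (auto intro: generate.incl)
  fix F and \<epsilon> :: real assume F: "finite F" "F \<subseteq> carrier G" and "\<epsilon> > 0"
  obtain C where C: "0 \<le> C" "\<And>g k. g \<in> F \<Longrightarrow> \<bar>d g k\<bar> \<le> C"
    using uniformly_bounded[OF F] by blast
  obtain q :: "int set \<Rightarrow> real" and D where q: "finite D" "D \<subseteq> half_lines"
      "\<forall>S. 0 \<le> q S" "\<forall>S. S \<notin> D \<longrightarrow> q S = 0" "sum q D = 1"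
    and q_inv: "\<forall>\<sigma>. bij \<sigma> \<and> (\<forall>j. \<bar>\<sigma> j - j\<bar> \<le> C) \<longrightarrow>
      (\<forall>S. S \<notin> D \<longrightarrow> q (\<sigma> ` S) = 0) \<and> (\<Sum>S\<in>D. \<bar>q (\<sigma> ` S) - q S\<bar>) \<le> \<epsilon>"
    using almost_invariant_on_half_lines[OF C(1) \<open>\<epsilon> > 0\<close>] by (elim exE conjE)
  have "bij (move g) \<and> (\<forall>j. \<bar>move g j - j\<bar> \<le> C)" if "g \<in> F" for g
    using that F(2) bij_move C(2) by (auto simp: move_def)
  then have "\<forall>g\<in>F. (\<forall>s. s \<notin> D \<longrightarrow> q (move g ` s) = 0) \<and> (\<Sum>s\<in>D. \<bar>q (move g ` s) - q s\<bar>) \<le> \<epsilon>"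
    using q_inv by simp
  then show "\<exists>(q :: int set \<Rightarrow> real) D. finite D \<and> D \<subseteq> half_lines \<and> (\<forall>s. 0 \<le> q s) \<and>
      (\<forall>s. s \<notin> D \<longrightarrow> q s = 0) \<and> sum q D = 1 \<and>
      (\<forall>g\<in>F. (\<forall>s. s \<notin> D \<longrightarrow> q (move g ` s) = 0) \<and> (\<Sum>s\<in>D. \<bar>q (move g ` s) - q s\<bar>) \<le> \<epsilon>)"
    using q by (intro exI[of _ q] exI[of _ D] conjI)
qed

end

section \<open>Cantor sets and their homeomorphism groups\<close>

text \<open>A point is mapped to its bits at those levels where its cylinder splits.\<close>

lemma cantor_setI:
  fixes X :: "'a topology"
  assumes compact: "compact_space X" and nonempty: "topspace X \<noteq> {}"
    and countable: "countable \<B>"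
    and clopen_\<B>: "\<And>U. U \<in> \<B> \<Longrightarrow> openin X U \<and> closedin X U"
    and separating_\<B>: "\<And>x y. \<lbrakk>x \<in> topspace X; y \<in> topspace X; x \<noteq> y\<rbrakk> \<Longrightarrow> \<exists>U\<in>\<B>. (x \<in> U) \<noteq> (y \<in> U)"
    and perfect: "\<And>x. x \<in> topspace X \<Longrightarrow> \<not> openin X {x}"
  shows "cantor_set X"
proof -
  let ?S = "topspace X"
  \<comment> \<open>The empty set makes the family nonempty and hence enumerable by
    \<open>from_nat_into\<close>. Neither it nor a repeated member splits a cylinder, so the levels
    in \<open>L\<close> are unaffected.\<close>
  define B where "B = from_nat_into (insert {} \<B>)"
  have range_B: "range B = insert {} \<B>"
    unfolding B_def using countable by (intro range_from_nat_into) auto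
  have clopen: "openin X (B n)" "closedin X (B n)" for n
    using range_B clopen_\<B> by (metis insert_iff openin_empty rangeI, metis insert_iff closedin_empty rangeI)
  have separating: "\<exists>n. (x \<in> B n) \<noteq> (y \<in> B n)" if "x \<in> ?S" "y \<in> ?S" "x \<noteq> y" for x y
    using separating_\<B>[OF that] range_B by (metis insert_iff rangeE)
  define agr where "agr n x y \<longleftrightarrow> (\<forall>i<n. (x \<in> B i) = (y \<in> B i))" for n x y
  define L where "L x = {n. \<exists>y\<in>?S. agr n x y \<and> (x \<in> B n) \<noteq> (y \<in> B n)}" for x
  have first: "\<exists>n. agr n x y \<and> (x \<in> B n) \<noteq> (y \<in> B n)" if xy: "x \<in> ?S" "y \<in> ?S" "x \<noteq> y" for x y
  proof -
    let ?n = "LEAST n. (x \<in> B n) \<noteq> (y \<in> B n)"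
    have "(x \<in> B ?n) \<noteq> (y \<in> B ?n)"
      using separating[OF xy] by (rule LeastI_ex)
    moreover have "agr ?n x y"
      unfolding agr_def using not_less_Least by blast
    ultimately show ?thesis
      by blast
  qed
  have agr_open: "openin X {y \<in> ?S. agr n x y}" for n x
  proof (induction n)
    case (Suc n)
    have "{y \<in> ?S. agr (Suc n) x y} = {y \<in> ?S. agr n x y} \<inter> (if x \<in> B n then B n else ?S - B n)"
      using openin_subset[OF clopen(1)[of n]] by (auto simp: agr_def less_Suc_eq)
    also have "openin X \<dots>"
      using Suc clopen by (auto intro!: openin_Int)
    finally show ?case .
  qed (simp add: agr_def)
  have inf: "infinite (L x)" if x: "x \<in> ?S" for x
  proof
    assume "finite (L x)"
    then obtain N where N: "\<And>n. n \<in> L x \<Longrightarrow> n < N"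
      using finite_nat_set_iff_bounded by auto
    have "y = x" if y: "y \<in> ?S" "agr N x y" for y
    proof (rule ccontr)
      assume "y \<noteq> x"
      then obtain n where n: "agr n x y" "(x \<in> B n) \<noteq> (y \<in> B n)"
        using first[OF x y(1)] by auto
      then have "n \<in> L x"
        using y(1) by (auto simp: L_def)
      then show False
        using N n(2) y(2) by (auto simp: agr_def)
    qed
    then have "{y \<in> ?S. agr N x y} = {x}"
      using x by (auto simp: agr_def)
    then show False
      using agr_open[of N x] perfect[OF x] by simp
  qed
  define e where "e x i = enumerate (L x) i" for x i
  define \<phi> where "\<phi> x i \<longleftrightarrow> x \<in> B (e x i)" for x i
  have e_mem: "e x i \<in> L x" if "x \<in> ?S" for x i
    unfolding e_def using inf[OF that] by (rule enumerate_in_set)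
  have e_less: "e x i < e x j" if "x \<in> ?S" "i < j" for x i j
    unfolding e_def using inf[OF that(1)] that(2) by (rule enumerate_mono[rotated])
  have e_ex: "\<exists>i. e x i = n" if "x \<in> ?S" "n \<in> L x" for x n
    unfolding e_def using inf[OF that(1)] that(2) by (rule enumerate_Ex)
  have e_card: "card (L x \<inter> {..<e x i}) = i" if x: "x \<in> ?S" for x i
  proof -
    have "L x \<inter> {..<e x i} = e x ` {..<i}"
    proof
      show "L x \<inter> {..<e x i} \<subseteq> e x ` {..<i}"
      proof
        fix n assume n: "n \<in> L x \<inter> {..<e x i}"
        then obtain j where j: "e x j = n"
          using e_ex[OF x] by auto
        have "j < i"
          using n j e_less[OF x, of i j] by (cases i j rule: linorder_cases) auto
        then show "n \<in> e x ` {..<i}"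
          using j by auto
      qed
    qed (use e_mem[OF x] e_less[OF x] in auto)
    moreover have "inj_on (e x) {..<i}"
      by (rule inj_onI) (metis e_less[OF x] linorder_less_linear less_irrefl)
    ultimately show ?thesis
      by (simp add: card_image)
  qed
  \<comment> \<open>A splitting level is recovered from the number of earlier ones. Points that
    agree below a level share those earlier levels, hence also its rank.\<close>
  have e_eq: "e x (card (L x \<inter> {..<n})) = n" if "x \<in> ?S" "n \<in> L x" for x n
    using e_ex[OF that] e_card[OF that(1)] by metis
  have L_agr: "L x \<inter> {..<n} = L y \<inter> {..<n}" if "agr n x y" for n x y
  proof -
    have "m \<in> L y" if "m \<in> L x" "m < n" "agr n x y" for m x y
    proof -
      obtain z where "z \<in> ?S" "agr m x z" "(x \<in> B m) \<noteq> (z \<in> B m)"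
        using \<open>m \<in> L x\<close> by (auto simp: L_def)
      then show ?thesis
        using \<open>m < n\<close> \<open>agr n x y\<close> by (auto simp: L_def agr_def intro!: bexI[of _ z])
    qed
    moreover have "agr n y x"
      using that by (auto simp: agr_def)
    ultimately show ?thesis
      using that by blast
  qed
  have e_agr: "e y i = e x i" if "x \<in> ?S" "y \<in> ?S" "agr (Suc (e x i)) x y" for x y i
  proof -
    let ?n = "e x i"
    have "?n \<in> L y"
      using L_agr[OF that(3)] e_mem[OF that(1), of i] by blast
    moreover have "L x \<inter> {..<?n} = L y \<inter> {..<?n}"
      using that(3) by (intro L_agr) (auto simp: agr_def)
    ultimately show ?thesis
      using e_eq[OF that(2), of ?n] e_card[OF that(1), of i] by simp
  qed
  have \<phi>_agr: "\<phi> y i = \<phi> x i" if "x \<in> ?S" "y \<in> ?S" "agr (Suc (e x i)) x y" for x y i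
    using e_agr[OF that] that(3) by (simp add: \<phi>_def agr_def)
  have \<phi>_open: "openin X {x \<in> ?S. \<phi> x i \<in> V}" for i V
  proof (subst openin_subopen, safe)
    fix x assume x: "x \<in> ?S" "\<phi> x i \<in> V"
    have "{y \<in> ?S. agr (Suc (e x i)) x y} \<subseteq> {x \<in> ?S. \<phi> x i \<in> V}"
    proof
      fix y assume "y \<in> {y \<in> ?S. agr (Suc (e x i)) x y}"
      then have "y \<in> ?S" "\<phi> y i = \<phi> x i"
        using \<phi>_agr[OF x(1)] by blast+
      then show "y \<in> {x \<in> ?S. \<phi> x i \<in> V}"
        using x(2) by simp
    qed
    moreover have "x \<in> {y \<in> ?S. agr (Suc (e x i)) x y}"
      using x(1) by (simp add: agr_def)
    ultimately show "\<exists>T. openin X T \<and> x \<in> T \<and> T \<subseteq> {x \<in> ?S. \<phi> x i \<in> V}"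
      using agr_open by blast
  qed
  then have "continuous_map X (discrete_topology UNIV) (\<lambda>x. \<phi> x i)" for i
    by (simp add: continuous_map_def)
  then have cont: "continuous_map X (product_topology (\<lambda>n::nat. discrete_topology (UNIV :: bool set)) UNIV) \<phi>"
    by (simp add: continuous_map_componentwise_UNIV)
  have inj: "inj_on \<phi> ?S"
  proof (rule inj_onI, rule ccontr)
    fix x y assume xy: "x \<in> ?S" "y \<in> ?S" "\<phi> x = \<phi> y" "x \<noteq> y"
    then obtain n where n: "agr n x y" "(x \<in> B n) \<noteq> (y \<in> B n)"
      using first by blast
    have "n \<in> L x" "n \<in> L y"
      using n xy(1,2) by (auto simp: L_def agr_def)
    then have "e x (card (L x \<inter> {..<n})) = n" "e y (card (L x \<inter> {..<n})) = n"
      using e_eq xy(1,2) L_agr[OF n(1)] by metis+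
    then show False
      using fun_cong[OF xy(3), of "card (L x \<inter> {..<n})"] n(2) by (simp add: \<phi>_def)
  qed
  \<comment> \<open>A wrong n-th bit is corrected by passing to the other half of the cylinder at
    its n-th splitting level. This changes none of the earlier bits, and the n-th splitting level
    stays the same.\<close>
  have dense: "\<exists>x\<in>?S. \<forall>i<n. \<phi> x i = w i" for n w
  proof (induction n)
    case 0
    then show ?case
      using nonempty by blast
  next
    case (Suc n)
    then obtain x where x: "x \<in> ?S" "\<forall>i<n. \<phi> x i = w i"
      by blast
    show ?case
    proof (cases "\<phi> x n = w n")
      case True
      then show ?thesis
        using x by (auto simp: less_Suc_eq)
    next
      case False
      let ?m = "e x n"
      obtain y where y: "y \<in> ?S" "agr ?m x y" "(x \<in> B ?m) \<noteq> (y \<in> B ?m)"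
        using e_mem[OF x(1), of n] by (auto simp: L_def)
      have "\<phi> y i = w i" if "i < n" for i
      proof -
        have "agr (Suc (e x i)) x y"
          using y(2) e_less[OF x(1) that] by (auto simp: agr_def)
        then show ?thesis
          using \<phi>_agr[OF x(1) y(1)] x(2) that by simp
      qed
      moreover have "e y n = ?m"
      proof -
        have "?m \<in> L y"
          using x(1) y by (auto simp: L_def agr_def)
        then show ?thesis
          using e_eq[OF y(1)] L_agr[OF y(2)] e_card[OF x(1), of n] by metis
      qed
      then have "\<phi> y n = w n"
        using y(3) False by (auto simp: \<phi>_def)
      ultimately show ?thesis
        using y(1) by (auto simp: less_Suc_eq)
    qed
  qed
  have "\<exists>x\<in>?S. \<phi> x = w" for w
  proof -
    define K where "K n = {x \<in> ?S. \<forall>i<n. \<phi> x i = w i}" for n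
    have "closedin X (K n)" for n
    proof -
      have "?S - K n = (\<Union>i<n. {x \<in> ?S. \<phi> x i \<in> {\<not> w i}})"
        by (auto simp: K_def)
      moreover have "openin X \<dots>"
        using \<phi>_open by (intro openin_Union) blast
      ultimately show ?thesis
        by (auto simp: closedin_def K_def)
    qed
    moreover have "K n \<noteq> {}" for n
      using dense[of n w] by (auto simp: K_def)
    moreover have "decseq K"
      by (auto simp: K_def decseq_def)
    ultimately have "(\<Inter>n. K n) \<noteq> {}"
      using compact_space_imp_nest[OF compact] by blast
    then obtain x where x: "\<And>n. x \<in> K n"
      by blast
    have "\<phi> x i = w i" for i
      using x[of "Suc i"] by (simp add: K_def)
    moreover have "x \<in> ?S"
      using x[of 0] by (simp add: K_def)
    ultimately show ?thesis
      by blast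
  qed
  then have "w \<in> \<phi> ` ?S" for w
    using imageI by metis
  then have "\<phi> ` ?S = topspace (product_topology (\<lambda>n::nat. discrete_topology (UNIV :: bool set)) UNIV)"
    by auto
  then have "homeomorphic_map X (product_topology (\<lambda>n::nat. discrete_topology (UNIV :: bool set)) UNIV) \<phi>"
    by (intro continuous_imp_homeomorphic_map compact cont inj)
      (simp_all add: Hausdorff_space_product_topology)
  then show ?thesis
    unfolding cantor_set_def using homeomorphic_map_imp_homeomorphic_space by blast
qed

lemma cantor_set_imp_compact_Hausdorff:
  assumes "cantor_set X"
  shows "compact_space X" "Hausdorff_space X"
  using assms unfolding cantor_set_def
  by (auto simp: homeomorphic_compact_space homeomorphic_Hausdorff_space
      compact_space_product_topology Hausdorff_space_product_topology compact_space_discrete_topology)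

lemma cantor_set_separating_clopens:
  assumes "cantor_set X"
  obtains B :: "nat \<Rightarrow> 'a set" where "\<And>n. openin X (B n)" "\<And>n. closedin X (B n)"
    "\<And>x y. \<lbrakk>x \<in> topspace X; y \<in> topspace X; x \<noteq> y\<rbrakk> \<Longrightarrow> \<exists>n. (x \<in> B n) \<noteq> (y \<in> B n)"
proof -
  let ?C = "product_topology (\<lambda>n::nat. discrete_topology (UNIV :: bool set)) UNIV"
  obtain f where f: "homeomorphic_map X ?C f"
    using assms unfolding cantor_set_def homeomorphic_space by blast
  have cont: "continuous_map X (discrete_topology UNIV) (\<lambda>x. f x n)" for n
    using homeomorphic_imp_continuous_map[OF f] by (auto simp: continuous_map_componentwise_UNIV)
  have inj: "inj_on f (topspace X)"
    using f by (rule homeomorphic_imp_injective_map)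
  show thesis
  proof (rule that[of "\<lambda>n. {x \<in> topspace X. f x n \<in> {True}}"])
    show "openin X {x \<in> topspace X. f x n \<in> {True}}" for n
      using cont by (rule openin_continuous_map_preimage) simp
    show "closedin X {x \<in> topspace X. f x n \<in> {True}}" for n
      using cont by (rule closedin_continuous_map_preimage) simp
    show "\<exists>n. (x \<in> {x \<in> topspace X. f x n \<in> {True}}) \<noteq> (y \<in> {x \<in> topspace X. f x n \<in> {True}})"
      if "x \<in> topspace X" "y \<in> topspace X" "x \<noteq> y" for x y
      using that inj by (auto simp: inj_on_def fun_eq_iff)
  qed
qed

lemma cantor_set_nonempty: "cantor_set X \<Longrightarrow> topspace X \<noteq> {}"
  unfolding cantor_set_def by (auto dest: homeomorphic_empty_space simp flip: null_topspace_iff_trivial)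

lemma cantor_set_perfect:
  assumes "cantor_set X"
  shows "\<not> openin X {x}"
proof
  let ?C = "product_topology (\<lambda>n::nat. discrete_topology (UNIV :: bool set)) UNIV"
  assume x: "openin X {x}"
  obtain f where f: "homeomorphic_map X ?C f"
    using assms unfolding cantor_set_def homeomorphic_space by blast
  have "openin ?C (f ` {x})"
    using homeomorphic_imp_open_map[OF f] x by (simp only: open_map_def)
  then have "openin ?C {f x}"
    by simp
  then obtain U where U: "finite {i. U i \<noteq> (UNIV :: bool set)}" "f x \<in> Pi\<^sub>E UNIV U" "Pi\<^sub>E UNIV U \<subseteq> {f x}"
    unfolding openin_product_topology_alt by auto
  then obtain i where i: "U i = UNIV"
    using infinite_UNIV_nat by (metis (mono_tags, lifting) UNIV_eq_I mem_Collect_eq)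
  have "(f x)(i := \<not> f x i) \<in> Pi\<^sub>E UNIV U"
    using U(2) i by (auto simp: PiE_iff)
  then have "(f x)(i := \<not> f x i) = f x"
    using U(3) by blast
  then show False
    by (metis fun_upd_same)
qed

section \<open>Calculation in homeomorphism groups and conjugation between spaces\<close>

lemma homeo_group_simps:
  "carrier (homeo_group X) = {h \<in> Bij (topspace X). homeomorphic_map X X h}"
  "\<lbrakk>g \<in> Bij (topspace X); h \<in> Bij (topspace X)\<rbrakk> \<Longrightarrow>
    g \<otimes>\<^bsub>homeo_group X\<^esub> h = compose (topspace X) g h"
  "\<one>\<^bsub>homeo_group X\<^esub> = (\<lambda>x\<in>topspace X. x)"
  by (auto simp: homeo_group_def BijGroup_def)

lemma homeo_group_mult_apply:
  "\<lbrakk>g \<in> carrier (homeo_group X); h \<in> carrier (homeo_group X); x \<in> topspace X\<rbrakk>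
    \<Longrightarrow> (g \<otimes>\<^bsub>homeo_group X\<^esub> h) x = g (h x)"
  by (simp add: homeo_group_simps compose_def)

lemma homeo_group_apply_mem:
  "\<lbrakk>g \<in> carrier (homeo_group X); x \<in> topspace X\<rbrakk> \<Longrightarrow> g x \<in> topspace X"
  by (auto simp: homeo_group_simps Bij_def bij_betw_def)

lemma homeo_group_eqI:
  "\<lbrakk>g \<in> carrier (homeo_group X); h \<in> carrier (homeo_group X); \<And>x. x \<in> topspace X \<Longrightarrow> g x = h x\<rbrakk> \<Longrightarrow> g = h"
  by (auto simp: homeo_group_simps Bij_def intro: extensionalityI)

text \<open>Conjugation by \<open>e\<close>, restricted because elements of
  \<open>homeo_group\<close> are extensional. It later moves the shift system to the standard Cantor
  space.\<close>

lemma transport_carrier: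
  assumes "homeomorphic_maps Y C e e'" "homeomorphic_maps Y Y f f'"
  shows "(\<lambda>x\<in>topspace C. e (f (e' x))) \<in> carrier (homeo_group C)"
proof -
  have "homeomorphic_map C C (e \<circ> (f \<circ> e'))"
    using assms unfolding homeomorphic_maps_map by (blast intro: homeomorphic_map_compose)
  then have homeo: "homeomorphic_map C C (\<lambda>x\<in>topspace C. e (f (e' x)))"
    by (rule homeomorphic_map_eq) simp
  then have "(\<lambda>x\<in>topspace C. e (f (e' x))) \<in> Bij (topspace C)"
    unfolding Bij_def bij_betw_def
    using homeomorphic_imp_injective_map[OF homeo] homeomorphic_imp_surjective_map[OF homeo]
    by (intro IntI CollectI conjI restrict_extensional)
  then show ?thesis
    using homeo by (simp add: homeo_group_simps)
qed

lemma transport_mult: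
  assumes e: "homeomorphic_maps Y C e e'"
    and f: "homeomorphic_maps Y Y f f'" and g: "homeomorphic_maps Y Y g g'" and h: "homeomorphic_maps Y Y h h'"
    and fg: "\<And>y. y \<in> topspace Y \<Longrightarrow> h y = f (g y)"
  shows "(\<lambda>x\<in>topspace C. e (f (e' x))) \<otimes>\<^bsub>homeo_group C\<^esub> (\<lambda>x\<in>topspace C. e (g (e' x))) =
    (\<lambda>x\<in>topspace C. e (h (e' x)))"
proof (rule homeo_group_eqI)
  note carrier = transport_carrier[OF e f] transport_carrier[OF e g] transport_carrier[OF e h]
  show "(\<lambda>x\<in>topspace C. e (f (e' x))) \<otimes>\<^bsub>homeo_group C\<^esub> (\<lambda>x\<in>topspace C. e (g (e' x)))
      \<in> carrier (homeo_group C)"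
    using group.is_monoid[OF group_homeo_group] carrier by (intro monoid.m_closed)
  show "(\<lambda>x\<in>topspace C. e (h (e' x))) \<in> carrier (homeo_group C)"
    by (rule carrier)
  fix x assume x: "x \<in> topspace C"
  have "e' x \<in> topspace Y"
    using e x by (auto simp: homeomorphic_maps_def continuous_map_def)
  moreover from this have "g (e' x) \<in> topspace Y"
    using g by (auto simp: homeomorphic_maps_def continuous_map_def)
  moreover from this have "e (g (e' x)) \<in> topspace C" "e' (e (g (e' x))) = g (e' x)"
    using e by (auto simp: homeomorphic_maps_def continuous_map_def)
  ultimately show "((\<lambda>x\<in>topspace C. e (f (e' x))) \<otimes>\<^bsub>homeo_group C\<^esub> (\<lambda>x\<in>topspace C. e (g (e' x)))) x =
      (\<lambda>x\<in>topspace C. e (h (e' x))) x"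
    using x carrier by (simp add: homeo_group_mult_apply fg)
qed

section \<open>Minimal dihedral actions\<close>

locale minimal_dihedral_action =
  fixes X :: "'a topology" and a b :: "'a \<Rightarrow> 'a"
  assumes cantor: "cantor_set X"
    and period_two_a: "period_two X a" and period_two_b: "period_two X b"
    and minimal: "minimal_action (subgroup_generated_by X {a, b}) X (\<lambda>h. h)"
begin

abbreviation S where "S \<equiv> topspace X"
abbreviation H where "H \<equiv> homeo_group X"

sublocale H: group H
  by (rule group_homeo_group)

lemma compact: "compact_space X" and Hausdorff: "Hausdorff_space X"
  using cantor_set_imp_compact_Hausdorff[OF cantor] by auto

lemma infinite_space: "infinite S"
proof
  assume "finite S"
  obtain x where x: "x \<in> S"
    using cantor_set_nonempty[OF cantor] by blast
  have "closedin X (S - {x})"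
    using Hausdorff \<open>finite S\<close> by (intro closedin_Hausdorff_finite) auto
  then have "openin X (S - (S - {x}))"
    by blast
  moreover have "S - (S - {x}) = {x}"
    using x by blast
  ultimately show False
    using cantor_set_perfect[OF cantor] by simp
qed

text \<open>The orbit of a point under the dihedral group is read off along a line on which the
  edge from \<open>k\<close> to \<open>k + 1\<close> is \<open>a\<close> for even \<open>k\<close> and \<open>b\<close> for odd \<open>k\<close>.\<close>

definition edge :: "int \<Rightarrow> 'a \<Rightarrow> 'a" where
  "edge k = (if even k then a else b)"

lemma edge_carrier: "edge k \<in> carrier H"
  using period_two_a period_two_b by (simp add: edge_def period_two_def)

lemma edge_mem [simp]: "x \<in> S \<Longrightarrow> edge k x \<in> S"
  using edge_carrier by (rule homeo_group_apply_mem)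

lemma edge_mult_edge: "edge k \<otimes>\<^bsub>H\<^esub> edge k = \<one>\<^bsub>H\<^esub>"
  using period_two_a period_two_b by (simp add: edge_def period_two_def)

lemma edge_edge [simp]: "x \<in> S \<Longrightarrow> edge k (edge k x) = x"
  using homeo_group_mult_apply[OF edge_carrier edge_carrier, of x k k]
  by (simp add: edge_mult_edge homeo_group_simps(3))

lemma edge_homeo: "homeomorphic_map X X (edge k)"
  using edge_carrier by (simp add: homeo_group_simps)

lemma edge_parity: "even (j - k) \<Longrightarrow> edge j = edge k"
  by (simp add: edge_def)

section \<open>Walks along dihedral orbits and their coincidences\<close>

definition is_line :: "(int \<Rightarrow> 'a) \<Rightarrow> bool" where
  "is_line s \<longleftrightarrow> (\<forall>k. s k \<in> S \<and> s (k + 1) = edge k (s k))"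

lemma is_line_mem: "is_line s \<Longrightarrow> s k \<in> S"
  and is_line_succ: "is_line s \<Longrightarrow> s (k + 1) = edge k (s k)"
  by (simp_all add: is_line_def)

lemma is_line_pred: "is_line s \<Longrightarrow> s k = edge k (s (k + 1))"
  by (simp add: is_line_def)

lemma is_line_shift: "\<lbrakk>is_line s; even m\<rbrakk> \<Longrightarrow> is_line (\<lambda>k. s (k + m))"
  unfolding is_line_def by (metis add.assoc add.commute add_diff_cancel_left' edge_parity)

text \<open>Under k -> m - k the edge starting at k becomes the one starting at m - k - 1, which has
  the same parity exactly for odd m.\<close>

lemma is_line_reflect:
  assumes "is_line s" "odd m"
  shows "is_line (\<lambda>k. s (m - k))"
  unfolding is_line_def
proof (intro allI conjI)
  fix k
  show "s (m - k) \<in> S"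
    using assms(1) by (rule is_line_mem)
  have "s (m - (k + 1)) = edge (m - (k + 1)) (s (m - (k + 1) + 1))"
    using assms(1) by (rule is_line_pred)
  also have "edge (m - (k + 1)) = edge k"
    using assms(2) by (intro edge_parity) auto
  finally show "s (m - (k + 1)) = edge k (s (m - k))"
    by simp
qed

lemma is_line_eqI:
  assumes "is_line s" "is_line s'" "s i = s' i"
  shows "s = s'"
proof
  fix k
  show "s k = s' k"
  proof (induction k rule: int_induct[where k = i])
    case (step2 j)
    then show ?case
      using is_line_pred[OF assms(1), of "j - 1"] is_line_pred[OF assms(2), of "j - 1"] by simp
  qed (use assms in \<open>auto simp: is_line_succ\<close>)
qed

text \<open>One coincidence propagates along the whole line, since any point determines its line:
  between indices of equal parity it gives a period, between indices of opposite parity a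
  reflection, as in \<open>is_line_symmetry\<close>.\<close>

lemma is_line_period: "\<lbrakk>is_line s; s i = s (i + m); even m\<rbrakk> \<Longrightarrow> s (k + m) = s k"
  using is_line_eqI[OF is_line_shift[of s m], of s i] by (metis (no_types))

lemma is_line_symmetry: "\<lbrakk>is_line s; s i = s (m - i); odd m\<rbrakk> \<Longrightarrow> s (m - k) = s k"
  using is_line_eqI[OF is_line_reflect[of s m], of s i] by (metis (no_types))

primrec forward :: "'a \<Rightarrow> nat \<Rightarrow> 'a" where
  "forward x 0 = x"
| "forward x (Suc n) = edge (int n) (forward x n)"

text \<open>The step from -n to -n - 1 crosses the edge that starts at -n - 1.\<close>

primrec backward :: "'a \<Rightarrow> nat \<Rightarrow> 'a" where
  "backward x 0 = x"
| "backward x (Suc n) = edge (- int (Suc n)) (backward x n)"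

definition line :: "'a \<Rightarrow> int \<Rightarrow> 'a" where
  "line x k = (if 0 \<le> k then forward x (nat k) else backward x (nat (- k)))"

lemma line_zero [simp]: "line x 0 = x"
  by (simp add: line_def)

lemma is_line_line:
  assumes "x \<in> S"
  shows "is_line (line x)"
proof -
  have fb: "forward x n \<in> S" "backward x n \<in> S" for n
    by (induction n) (use assms in auto)
  have "line x (k + 1) = edge k (line x k)" for k
  proof (cases "0 \<le> k")
    case True
    then have "nat (k + 1) = Suc (nat k)"
      by simp
    then show ?thesis
      using True by (simp add: line_def)
  next
    case False
    define n where "n = nat (- k - 1)"
    have n: "nat (- k) = Suc n" "k = - int (Suc n)"
      using False by (auto simp: n_def)
    have "line x k = edge k (backward x n)"
      using False n by (simp add: line_def)
    moreover have "line x (k + 1) = backward x n"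
    proof (cases "n = 0")
      case False
      then have "\<not> 0 \<le> k + 1" "nat (- (k + 1)) = n"
        using n by auto
      then show ?thesis
        by (simp only: line_def if_False)
    qed (use n in \<open>simp add: line_def\<close>)
    ultimately show ?thesis
      using fb by simp
  qed
  then show ?thesis
    using fb by (simp add: is_line_def) (simp add: line_def)
qed

lemma homeo_line: "homeomorphic_map X X (\<lambda>x. line x k)"
proof -
  have id: "homeomorphic_map X X (\<lambda>x. x)"
    using homeomorphic_map_eq[of X X id] by simp
  have "homeomorphic_map X X (\<lambda>x. forward x n)" for n
    by (induction n) (use id homeomorphic_map_compose[OF _ edge_homeo] in \<open>auto simp: o_def\<close>)
  moreover have "homeomorphic_map X X (\<lambda>x. backward x n)" for n
    by (induction n) (use id homeomorphic_map_compose[OF _ edge_homeo] in \<open>auto simp: o_def\<close>)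
  ultimately show ?thesis
    by (cases "0 \<le> k") (simp_all add: line_def)
qed

text \<open>An odd shift would exchange the roles of a and b, so odd positions are reached by a
  reflection.\<close>

lemma line_through:
  assumes "x \<in> S"
  obtains s where "is_line s" "s k = x"
proof (cases "even k")
  case True
  then show ?thesis
    using that[OF is_line_shift[OF is_line_line[OF assms], of "- k"]] by simp
next
  case False
  then show ?thesis
    using that[OF is_line_reflect[OF is_line_line[OF assms], of k]] by simp
qed

text \<open>The range of a line is stable under both involutions and therefore contains a whole
  dihedral orbit.\<close>

lemma line_dense:
  assumes s: "is_line s"
  shows "X closure_of (range s) = S"
proof -
  let ?D = "subgroup_generated_by X {a, b}"
  have car: "carrier ?D \<subseteq> carrier H"
    unfolding subgroup_generated_by_def
    using H.generate_incl[of "{a, b}"] edge_carrier[of 0] edge_carrier[of 1] by (simp add: edge_def)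
  have edge_range: "edge j (s k) \<in> range s" for j k
  proof (cases "even (j - k)")
    case True
    then show ?thesis
      using is_line_succ[OF s, of k] edge_parity by (metis rangeI)
  next
    case False
    then have "edge j = edge (k - 1)"
      by (intro edge_parity) auto
    then show ?thesis
      using is_line_pred[OF s, of "k - 1"] by (metis diff_add_cancel rangeI)
  qed
  have gen: "h (s k) \<in> range s" if "h \<in> generate H {a, b}" for h k
    using that
  proof (induction h arbitrary: k rule: generate.induct)
    case one
    then show ?case
      using is_line_mem[OF s] by (simp add: homeo_group_simps)
  next
    case (incl h)
    then show ?case
      using edge_range[of 0] edge_range[of 1] by (auto simp: edge_def)
  next
    case (inv h)
    have "inv\<^bsub>H\<^esub> edge j = edge j" for j
      by (intro H.inv_equality edge_carrier edge_mult_edge)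
    from this[of 0] this[of 1] have "inv\<^bsub>H\<^esub> h = h"
      using inv by (auto simp: edge_def)
    then show ?case
      using inv edge_range[of 0] edge_range[of 1] by (auto simp: edge_def)
  next
    case (eng h1 h2)
    then have "h1 \<in> carrier H" "h2 \<in> carrier H"
      using car by (auto simp: subgroup_generated_by_def)
    moreover obtain j where "h2 (s k) = s j"
      using eng.IH(2)[of k] by blast
    ultimately show ?case
      using eng.IH(1)[of j] is_line_mem[OF s] by (simp add: homeo_group_mult_apply)
  qed
  have "orbit ?D (\<lambda>h. h) (s 0) \<subseteq> range s"
    using gen by (auto simp: orbit_def subgroup_generated_by_def)
  then have "X closure_of (orbit ?D (\<lambda>h. h) (s 0)) \<subseteq> X closure_of (range s)"
    by (rule closure_of_mono)
  then show ?thesis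
    using minimal is_line_mem[OF s, of 0] closure_of_subset_topspace[of X "range s"]
    unfolding minimal_action_def by auto
qed

text \<open>A periodic line has finite range. Finite sets are closed, so density would make the
  whole space finite.\<close>

lemma line_not_periodic:
  assumes s: "is_line s" and "m \<noteq> 0" and per: "\<And>k. s (k + m) = s k"
  shows False
proof -
  have "s (k + n * m) = s k" for n k
  proof (induction n rule: int_induct[where k = 0])
    case (step1 n)
    then show ?case
      using per[of "k + n * m"] by (simp add: algebra_simps)
  next
    case (step2 n)
    then show ?case
      using per[of "k + (n - 1) * m"] by (simp add: algebra_simps)
  qed simp
  then have "s k = s (k mod m)" for k
    by (metis mod_div_decomp add.commute)
  moreover have "k mod m \<in> {- \<bar>m\<bar>..\<bar>m\<bar>}" for k
    using abs_mod_less[OF \<open>m \<noteq> 0\<close>, of k] by (auto simp: abs_le_iff)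
  ultimately have "range s \<subseteq> s ` {- \<bar>m\<bar>..\<bar>m\<bar>}"
    by (metis image_eqI image_subsetI)
  then have "finite (range s)"
    by (rule finite_subset) simp
  then have "closedin X (range s)"
    using Hausdorff is_line_mem[OF s] by (intro closedin_Hausdorff_finite) auto
  then have "range s = S"
    using line_dense[OF s] by (simp add: closure_of_closedin)
  then show False
    using \<open>finite (range s)\<close> infinite_space by simp
qed

text \<open>Each fixed point folds the line through it. If fixed points filled an open set, density
  and the absence of isolated points would give two folds on one line, and the two reflections
  compose to a nonzero period.\<close>

lemma fixed_points_nowhere_dense: "X interior_of {x \<in> S. edge k x = x} = {}"
proof (rule ccontr)
  define U where "U = X interior_of {x \<in> S. edge k x = x}"
  assume "X interior_of {x \<in> S. edge k x = x} \<noteq> {}"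
  then obtain x where x: "x \<in> U"
    by (auto simp: U_def)
  have U: "openin X U" "U \<subseteq> {x \<in> S. edge k x = x}"
    by (auto simp: U_def interior_of_subset)
  then have "x \<in> S"
    using x by auto
  then obtain s where s: "is_line s" "s k = x"
    by (rule line_through)
  have fixed: "s (k + 1) = s k"
    using is_line_succ[OF s(1), of k] s(2) U(2) x by auto
  then have sym: "s (2 * k + 1 - j) = s j" for j
    by (intro is_line_symmetry[OF s(1), of k]) auto
  have "openin X (U - {x})"
    using U(1) Hausdorff \<open>x \<in> S\<close> by (intro openin_diff closedin_Hausdorff_sing_eq[THEN iffD2]) auto
  moreover have "U - {x} \<noteq> {}"
    using cantor_set_perfect[OF cantor, of x] U(1) x by (metis Diff_eq_empty_iff subset_singletonD empty_iff)
  ultimately have "range s \<inter> (U - {x}) \<noteq> {}"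
    using line_dense[OF s(1)] by (metis dense_intersects_open)
  then obtain n where n: "s n \<in> U" "s n \<noteq> x"
    by blast
  have fix_n: "edge k (s n) = s n"
    using n(1) U(2) by auto
  show False
  \<comment> \<open>Parity decides whether the edge fixed at \<open>s n\<close> is the one after n
    or the one before it, so the second fold sits at n + 1/2 or at n - 1/2.\<close>
  proof (cases "even (n - k)")
    case True
    then have "s (n + 1) = s n"
      using is_line_succ[OF s(1), of n] fix_n edge_parity[OF True] by simp
    then have "s (2 * n + 1 - j) = s j" for j
      by (intro is_line_symmetry[OF s(1), of n]) auto
    from this[of "2 * k + 1 - j" for j] have "s (j + 2 * (n - k)) = s j" for j
      using sym[of j] by (simp add: algebra_simps)
    moreover have "n \<noteq> k"
      using n(2) s(2) by auto
    ultimately show False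
      using line_not_periodic[OF s(1), of "2 * (n - k)"] by simp
  next
    case False
    then have "edge k = edge (n - 1)"
      by (intro edge_parity) auto
    then have "s (n - 1) = s n"
      using is_line_pred[OF s(1), of "n - 1"] fix_n by simp
    then have "s (2 * n - 1 - j) = s j" for j
      by (intro is_line_symmetry[OF s(1), of n]) auto
    from this[of "2 * k + 1 - j" for j] have "s (j + 2 * (n - k - 1)) = s j" for j
      using sym[of j] by (simp add: algebra_simps)
    moreover have "n \<noteq> k + 1"
      using n(2) s(2) fixed by auto
    ultimately show False
      using line_not_periodic[OF s(1), of "2 * (n - k - 1)"] by simp
  qed
qed

text \<open>By Baire some starting point avoids every \<open>T k\<close>, the closed set of points
  whose line folds between k and k + 1. Without folds a coincidence of opposite parity cannot occur,
  and one of equal parity would be a period.\<close>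

lemma free_line:
  obtains s where "is_line s" "inj s"
proof -
  define T where "T k = {x \<in> S. line x (k + 1) = line x k}" for k
  have "closedin X (T k)" for k
    unfolding T_def
    using homeomorphic_imp_continuous_map[OF homeo_line[of "k + 1"]]
      homeomorphic_imp_continuous_map[OF homeo_line[of k]]
    by (intro closedin_continuous_maps_eq[OF Hausdorff]) auto
  moreover have "X interior_of (T k) = {}" for k
  proof -
    let ?U = "X interior_of (T k)"
    have "openin X ((\<lambda>x. line x k) ` ?U)"
      using homeomorphic_imp_open_map[OF homeo_line[of k]] by (simp only: open_map_def openin_interior_of)
    moreover have "(\<lambda>x. line x k) ` ?U \<subseteq> {x \<in> S. edge k x = x}"
      using interior_of_subset[of X "T k"] is_line_succ[OF is_line_line] is_line_mem[OF is_line_line]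
      by (fastforce simp: T_def)
    ultimately have "(\<lambda>x. line x k) ` ?U \<subseteq> X interior_of {x \<in> S. edge k x = x}"
      by (metis interior_of_maximal)
    then show ?thesis
      using fixed_points_nowhere_dense by simp
  qed
  ultimately have "X interior_of \<Union>(range T) = {}"
    using compact Hausdorff
    by (intro Baire_category_alt disjI2 conjI compact_imp_locally_compact_space
        compact_Hausdorff_imp_regular_space) auto
  then have "\<Union>(range T) \<noteq> S"
    using cantor_set_nonempty[OF cantor] by auto
  then obtain x where x: "x \<in> S" "\<And>k. x \<notin> T k"
    by (auto simp: T_def)
  let ?s = "line x"
  have s: "is_line ?s"
    using x(1) by (rule is_line_line)
  have no_fix: "?s (k + 1) \<noteq> ?s k" for k
    using x by (auto simp: T_def)
  have "inj ?s"
  proof (rule injI, rule ccontr)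
    fix i j assume ij: "?s i = ?s j" "i \<noteq> j"
    show False
    proof (cases "even (j - i)")
      case True
      then have "?s (k + (j - i)) = ?s k" for k
        using is_line_period[OF s, of i "j - i"] ij(1) by simp
      then show False
        using line_not_periodic[OF s, of "j - i"] ij(2) by simp
    next
      case False
      then have "odd (i + j)"
        by auto
      then obtain p where p: "i + j = 2 * p + 1"
        by (rule oddE)
      \<comment> \<open>The reflection exchanging i and j has centre p + 1/2, so it identifies the
        neighbours p and p + 1.\<close>
      have "?s i = ?s (i + j - i)"
        using ij(1) by simp
      then have "?s (i + j - p) = ?s p"
        using is_line_symmetry[OF s] \<open>odd (i + j)\<close> by blast
      moreover have "i + j - p = p + 1"
        using p by simp
      ultimately show False
        using no_fix[of p] by simp
    qed
  qed
  then show thesis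
    using that s by blast
qed

text \<open>Points are closed and not open, so Baire applies to the singletons. This later excludes
  isolated points of the shift space.\<close>

lemma uncountable_space: "uncountable S"
proof
  assume "countable S"
  then have "X interior_of \<Union>((\<lambda>x. {x}) ` S) = {}"
  proof (intro Baire_category_alt disjI2 conjI countable_image)
    show "locally_compact_space X" "regular_space X"
      using compact Hausdorff by (auto intro: compact_imp_locally_compact_space compact_Hausdorff_imp_regular_space)
    fix T assume "T \<in> (\<lambda>x. {x}) ` S"
    then obtain x where x: "T = {x}" "x \<in> S"
      by blast
    then show "closedin X T"
      using Hausdorff by (simp add: closedin_Hausdorff_sing_eq)
    have "X interior_of {x} \<noteq> {x}"
      using cantor_set_perfect[OF cantor, of x] openin_interior_of[of X "{x}"] by metis
    then show "X interior_of T = {}"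
      using interior_of_subset[of X T] x(1) by blast
  qed
  then show False
    using cantor_set_nonempty[OF cantor] by simp
qed

end

section \<open>Fragmentations\<close>

text \<open>Every element is a word in generators and inverses. Countability of \<Gamma> limits the
  relevant label coordinates of the shift space to a countable family, as \<open>cantor_setI\<close>
  requires.\<close>

lemma (in group) countable_generate:
  assumes "countable K" "K \<subseteq> carrier G"
  shows "countable (generate G K)"
proof -
  let ?W = "K \<union> (\<lambda>g. inv g) ` K"
  define eval where "eval l = foldr (\<otimes>) l \<one>" for l
  have eval_closed: "eval l \<in> carrier G" if "l \<in> lists ?W" for l
    using that assms(2) by (induction l) (auto simp: eval_def)
  have eval_append: "eval (l @ l') = eval l \<otimes> eval l'" if "l \<in> lists ?W" "l' \<in> lists ?W" for l l'
    using that(1)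
  proof (induction l)
    case Nil
    then show ?case
      using eval_closed[OF that(2)] by (simp add: eval_def)
  next
    case (Cons g l)
    then have "g \<in> carrier G" "eval l \<in> carrier G"
      using assms(2) eval_closed by auto
    then show ?case
      using Cons eval_closed[OF that(2)] m_assoc by (simp add: eval_def)
  qed
  have "generate G K \<subseteq> eval ` lists ?W"
  proof
    fix g assume "g \<in> generate G K"
    then show "g \<in> eval ` lists ?W"
    proof (induction g rule: generate.induct)
      case one
      show ?case
        by (intro image_eqI[of _ _ "[]"]) (auto simp: eval_def)
    next
      case (incl h)
      then show ?case
        using assms(2) by (intro image_eqI[of _ _ "[h]"]) (auto simp: eval_def)
    next
      case (inv h)
      then show ?case
        using assms(2) by (intro image_eqI[of _ _ "[inv h]"]) (auto simp: eval_def)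
    next
      case (eng h1 h2)
      then obtain l1 l2 where "l1 \<in> lists ?W" "h1 = eval l1" "l2 \<in> lists ?W" "h2 = eval l2"
        by blast
      then show ?case
        using eval_append by (intro image_eqI[of _ _ "l1 @ l2"]) auto
    qed
  qed
  then show ?thesis
    by (rule countable_subset) (use assms(1) in auto)
qed

locale fragmented_dihedral_action = minimal_dihedral_action +
  fixes A B :: "('a \<Rightarrow> 'a) set"
  assumes frag_A: "fragmentation X a A" and frag_B: "fragmentation X b B"
begin

definition \<Gamma> :: "('a \<Rightarrow> 'a) set" where
  "\<Gamma> = generate H (A \<union> B)"

lemma fragments_carrier: "A \<union> B \<subseteq> carrier H"
  using frag_A frag_B by (auto simp: fragmentation_def dest: subgroup.subset)

lemma \<Gamma>_carrier: "g \<in> \<Gamma> \<Longrightarrow> g \<in> carrier H"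
  unfolding \<Gamma>_def using H.generate_in_carrier[OF fragments_carrier] .

lemma subgroup_\<Gamma>: "subgroup \<Gamma> H"
  unfolding \<Gamma>_def using fragments_carrier by (rule H.generate_is_subgroup)

lemmas \<Gamma>_one = subgroup.one_closed[OF subgroup_\<Gamma>]
  and \<Gamma>_mult = subgroup.m_closed[OF subgroup_\<Gamma>]
  and \<Gamma>_inv = subgroup.m_inv_closed[OF subgroup_\<Gamma>]

lemma countable_\<Gamma>: "countable \<Gamma>"
  unfolding \<Gamma>_def using frag_A frag_B fragments_carrier
  by (intro H.countable_generate) (auto simp: fragmentation_def countable_finite)

lemma \<Gamma>_mult_apply: "\<lbrakk>g \<in> \<Gamma>; h \<in> \<Gamma>; x \<in> S\<rbrakk> \<Longrightarrow> (g \<otimes>\<^bsub>H\<^esub> h) x = g (h x)"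
  using \<Gamma>_carrier by (intro homeo_group_mult_apply)

section \<open>Displacements along a free line\<close>

definition c :: "int \<Rightarrow> 'a" where
  "c = (SOME s. is_line s \<and> inj s)"

lemma is_line_c: "is_line c" and inj_c: "inj c"
proof -
  have "\<exists>s. is_line s \<and> inj s"
    using free_line by blast
  then have "is_line c \<and> inj c"
    unfolding c_def by (rule someI_ex)
  then show "is_line c" "inj c"
    by auto
qed

lemma c_mem [simp]: "c k \<in> S"
  using is_line_c by (rule is_line_mem)

text \<open>A fragment fixes a point of the line or moves it to one of its two neighbours. Along a
  word the bounds add up, independently of the position.\<close>

lemma bounded_displacement:
  assumes "g \<in> \<Gamma>"
  shows "\<exists>C. \<forall>k. \<exists>d. \<bar>d\<bar> \<le> C \<and> g (c k) = c (k + d)"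
proof -
  have edge_c: "\<exists>d. \<bar>d\<bar> \<le> 1 \<and> edge j (c k) = c (k + d)" for j k
  proof (cases "even (j - k)")
    case True
    then have "edge j (c k) = c (k + 1)"
      using is_line_succ[OF is_line_c, of k] edge_parity[OF True] by simp
    then show ?thesis
      by (intro exI[of _ 1]) simp
  next
    case False
    then have "edge j = edge (k - 1)"
      by (intro edge_parity) auto
    then have "edge j (c k) = c (k + - 1)"
      using is_line_pred[OF is_line_c, of "k - 1"] by simp
    then show ?thesis
      by (intro exI[of _ "-1"]) simp
  qed
  have fragment: "\<exists>d. \<bar>d\<bar> \<le> 1 \<and> h (c k) = c (k + d)" if "h \<in> A \<union> B" for h k
  proof -
    have "\<forall>x\<in>S. h x = x \<or> h x = edge 0 x \<or> h x = edge 1 x"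
      using that frag_A frag_B by (auto simp: fragmentation_def edge_def)
    then have "h (c k) = c (k + 0) \<or> h (c k) = edge 0 (c k) \<or> h (c k) = edge 1 (c k)"
      using c_mem[of k] by simp
    then show ?thesis
      using edge_c[of 0 k] edge_c[of 1 k] by (metis abs_zero zero_le_one)
  qed
  show ?thesis
    using assms unfolding \<Gamma>_def
  proof (induction g rule: generate.induct)
    case one
    then show ?case
      by (intro exI[of _ 0] allI) (simp add: homeo_group_simps)
  next
    case (incl h)
    then show ?case
      using fragment by (intro exI[of _ 1]) auto
  next
    case (inv h)
    then have "inv\<^bsub>H\<^esub> h \<in> A \<union> B"
      using frag_A frag_B by (auto simp: fragmentation_def subgroup.m_inv_closed)
    then show ?case
      using fragment by (intro exI[of _ 1]) auto
  next
    case (eng g h)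
    then obtain C C' where C: "\<forall>k. \<exists>d. \<bar>d\<bar> \<le> C \<and> g (c k) = c (k + d)"
      and C': "\<forall>k. \<exists>d. \<bar>d\<bar> \<le> C' \<and> h (c k) = c (k + d)"
      by blast
    have "\<exists>d. \<bar>d\<bar> \<le> C + C' \<and> (g \<otimes>\<^bsub>H\<^esub> h) (c k) = c (k + d)" for k
    proof -
      obtain d where d: "\<bar>d\<bar> \<le> C'" "h (c k) = c (k + d)"
        using C' by blast
      obtain d' where d': "\<bar>d'\<bar> \<le> C" "g (c (k + d)) = c (k + d + d')"
        using C by blast
      have "(g \<otimes>\<^bsub>H\<^esub> h) (c k) = c (k + (d + d'))"
        using eng(1,2) d d' by (simp add: \<Gamma>_mult_apply[unfolded \<Gamma>_def] add.assoc)
      then show ?thesis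
        using d d' by (intro exI[of _ "d + d'"]) simp
    qed
    then show ?case
      by blast
  qed
qed

definition disp :: "('a \<Rightarrow> 'a) \<Rightarrow> int \<Rightarrow> int" where
  "disp g k = (if g \<in> \<Gamma> then THE d. g (c k) = c (k + d) else 0)"

definition bd :: "('a \<Rightarrow> 'a) \<Rightarrow> int" where
  "bd g = (if g \<in> \<Gamma> then SOME C. \<forall>k. \<bar>disp g k\<bar> \<le> C else 0)"

lemma disp_eqI: "\<lbrakk>g \<in> \<Gamma>; g (c k) = c (k + d)\<rbrakk> \<Longrightarrow> disp g k = d"
  using inj_c by (auto simp: disp_def inj_eq intro!: the_equality)

lemma apply_c: "g \<in> \<Gamma> \<Longrightarrow> g (c k) = c (k + disp g k)"
  using bounded_displacement[of g] disp_eqI by metis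

lemma disp_le_bd: "\<bar>disp g k\<bar> \<le> bd g"
proof (cases "g \<in> \<Gamma>")
  case True
  have "\<exists>C. \<forall>k. \<bar>disp g k\<bar> \<le> C"
    using bounded_displacement[OF True] disp_eqI[OF True] by metis
  then have "\<forall>k. \<bar>disp g k\<bar> \<le> (SOME C. \<forall>k. \<bar>disp g k\<bar> \<le> C)"
    by (rule someI_ex)
  then show ?thesis
    using True by (simp add: bd_def)
qed (simp add: disp_def bd_def)

lemma disp_one: "disp \<one>\<^bsub>H\<^esub> k = 0"
  using \<Gamma>_one by (intro disp_eqI) (simp_all add: homeo_group_simps)

lemma disp_mult: "\<lbrakk>g \<in> \<Gamma>; h \<in> \<Gamma>\<rbrakk> \<Longrightarrow> disp (g \<otimes>\<^bsub>H\<^esub> h) k = disp h k + disp g (k + disp h k)"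
  by (intro disp_eqI \<Gamma>_mult) (simp_all add: \<Gamma>_mult_apply apply_c add.assoc)

text \<open>The line is dense, and a continuous map fixing a dense subset of a Hausdorff space fixes
  everything.\<close>

lemma disp_faithful:
  assumes g: "g \<in> \<Gamma>" and fixed: "\<And>k. disp g k = 0"
  shows "g = \<one>\<^bsub>H\<^esub>"
proof (rule homeo_group_eqI)
  show "g \<in> carrier H" "\<one>\<^bsub>H\<^esub> \<in> carrier H"
    using \<Gamma>_carrier[OF g] by simp_all
  fix x assume x: "x \<in> S"
  have cont: "continuous_map X X g"
    using \<Gamma>_carrier[OF g] by (simp add: homeo_group_simps homeomorphic_imp_continuous_map)
  have "g y = y" if "y \<in> X closure_of (range c)" for y
    using forall_in_closure_of_eq[OF that Hausdorff cont continuous_map_id[unfolded id_def]] apply_c[OF g] fixed by auto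
  then show "g x = \<one>\<^bsub>H\<^esub> x"
    using x line_dense[OF is_line_c] by (simp add: homeo_group_simps)
qed

end

section \<open>The shift space\<close>

context fragmented_dihedral_action begin

text \<open>A point of \<open>P\<close> lists, along a line, the points of \<open>X\<close> visited and the displacement prescribed there
  for each element of \<open>\<Gamma>\<close>; \<open>bd\<close> bounds the displacements, which makes \<open>P\<close> compact. Displacements of
  maps outside \<open>\<Gamma>\<close> are set to \<open>0\<close>.\<close>

definition P :: "(int \<Rightarrow> 'a \<times> (('a \<Rightarrow> 'a) \<Rightarrow> int)) topology" where
  "P = product_topology (\<lambda>_. prod_topology X
     (product_topology (\<lambda>g. discrete_topology {- bd g..bd g}) UNIV)) UNIV"

definition pos :: "(int \<Rightarrow> 'a \<times> (('a \<Rightarrow> 'a) \<Rightarrow> int)) \<Rightarrow> int \<Rightarrow> 'a" where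
  "pos y k = fst (y k)"

definition lab :: "(int \<Rightarrow> 'a \<times> (('a \<Rightarrow> 'a) \<Rightarrow> int)) \<Rightarrow> int \<Rightarrow> ('a \<Rightarrow> 'a) \<Rightarrow> int" where
  "lab y k g = snd (y k) g"

definition shift :: "int \<Rightarrow> (int \<Rightarrow> 'a \<times> (('a \<Rightarrow> 'a) \<Rightarrow> int)) \<Rightarrow> int \<Rightarrow> 'a \<times> (('a \<Rightarrow> 'a) \<Rightarrow> int)" where
  "shift n y = (\<lambda>k. y (k + n))"

text \<open>Reversing a line also reverses the direction in which displacements are counted, whence
  the sign.\<close>

definition flip :: "(int \<Rightarrow> 'a \<times> (('a \<Rightarrow> 'a) \<Rightarrow> int)) \<Rightarrow> int \<Rightarrow> 'a \<times> (('a \<Rightarrow> 'a) \<Rightarrow> int)" where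
  "flip y = (\<lambda>k. (pos y (- k), \<lambda>g. - lab y (- k) g))"

definition y0 :: "int \<Rightarrow> 'a \<times> (('a \<Rightarrow> 'a) \<Rightarrow> int)" where
  "y0 = (\<lambda>k. (c k, \<lambda>g. disp g k))"

definition orbit_closure :: "(int \<Rightarrow> 'a \<times> (('a \<Rightarrow> 'a) \<Rightarrow> int)) \<Rightarrow> (int \<Rightarrow> 'a \<times> (('a \<Rightarrow> 'a) \<Rightarrow> int)) set" where
  "orbit_closure y = P closure_of (range (\<lambda>n. shift n y))"

definition K :: "(int \<Rightarrow> 'a \<times> (('a \<Rightarrow> 'a) \<Rightarrow> int)) set" where
  "K = orbit_closure y0"

lemma eq_by_pos_lab: "\<lbrakk>\<And>k. pos y k = pos z k; \<And>k g. lab y k g = lab z k g\<rbrakk> \<Longrightarrow> y = z"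
  by (auto simp: pos_def lab_def fun_eq_iff prod_eq_iff)

lemma pos_lab_simps [simp]:
  "pos (shift n y) k = pos y (k + n)" "lab (shift n y) k g = lab y (k + n) g"
  "pos (flip y) k = pos y (- k)" "lab (flip y) k g = - lab y (- k) g"
  "pos y0 k = c k" "lab y0 k g = disp g k"
  by (simp_all add: pos_def lab_def shift_def flip_def y0_def)

lemma shift_zero [simp]: "shift 0 y = y" and shift_shift [simp]: "shift m (shift n y) = shift (m + n) y"
  by (auto simp: shift_def add_ac)

lemma flip_shift: "flip (shift n y) = shift (- n) (flip y)" and flip_flip [simp]: "flip (flip y) = y"
  by (auto intro!: eq_by_pos_lab)

lemma P_topspace: "y \<in> topspace P \<longleftrightarrow> (\<forall>k. pos y k \<in> S \<and> (\<forall>g. \<bar>lab y k g\<bar> \<le> bd g))"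
  by (auto simp: P_def pos_def lab_def PiE_iff mem_Times_iff abs_le_iff minus_le_iff)

lemma compact_P: "compact_space P"
  using compact unfolding P_def
  by (auto simp: compact_space_product_topology compact_space_prod_topology compact_space_discrete_topology)

lemma continuous_coordinate:
  "continuous_map P (prod_topology X (product_topology (\<lambda>g. discrete_topology {- bd g..bd g}) UNIV)) (\<lambda>y. y k)"
  unfolding P_def by (rule continuous_map_product_projection) simp

lemma continuous_pos: "continuous_map P X (\<lambda>y. pos y k)"
  using continuous_map_fst_of[OF continuous_coordinate] by (simp add: o_def pos_def)

lemma continuous_lab: "continuous_map P (discrete_topology {- bd g..bd g}) (\<lambda>y. lab y k g)"
proof -
  have "continuous_map P (product_topology (\<lambda>g. discrete_topology {- bd g..bd g}) UNIV) (\<lambda>y. snd (y k))"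
    using continuous_map_snd_of[OF continuous_coordinate] by (simp add: o_def)
  then show ?thesis
    by (simp add: lab_def continuous_map_componentwise_UNIV)
qed

lemma lab_clopen: "openin P {y \<in> topspace P. lab y k g \<in> D}" "closedin P {y \<in> topspace P. lab y k g \<in> D}"
proof -
  have eq: "{y \<in> topspace P. lab y k g \<in> D} = {y \<in> topspace P. lab y k g \<in> D \<inter> {- bd g..bd g}}"
    by (auto simp: P_topspace abs_le_iff minus_le_iff)
  show "openin P {y \<in> topspace P. lab y k g \<in> D}"
    unfolding eq using continuous_lab by (rule openin_continuous_map_preimage) simp
  show "closedin P {y \<in> topspace P. lab y k g \<in> D}"
    unfolding eq using continuous_lab by (rule closedin_continuous_map_preimage) simp
qed

lemma continuous_into_P:
  assumes "\<And>k. continuous_map Z X (\<lambda>z. pos (f z) k)"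
    and "\<And>k g. continuous_map Z (discrete_topology {- bd g..bd g}) (\<lambda>z. lab (f z) k g)"
  shows "continuous_map Z P f"
proof -
  have "continuous_map Z P (\<lambda>z k. (pos (f z) k, \<lambda>g. lab (f z) k g))"
    unfolding P_def
    by (intro continuous_map_componentwise_UNIV[THEN iffD2] allI continuous_map_pairedI assms)
  then show ?thesis
    by (simp add: pos_def lab_def)
qed

lemma continuous_shift: "continuous_map P P (shift n)"
  by (rule continuous_into_P) (simp_all add: continuous_pos continuous_lab)

lemma continuous_flip: "continuous_map P P flip"
proof (rule continuous_into_P)
  fix k g
  have "continuous_map P (discrete_topology {- bd g..bd g}) (uminus \<circ> (\<lambda>y. lab y (- k) g))"
    using continuous_lab by (rule continuous_map_compose) auto
  then show "continuous_map P (discrete_topology {- bd g..bd g}) (\<lambda>y. lab (flip y) k g)"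
    by (simp add: o_def)
qed (simp add: continuous_pos)

lemma y0_P: "y0 \<in> topspace P"
  by (simp add: P_topspace disp_le_bd)

lemma shift_P [simp]: "y \<in> topspace P \<Longrightarrow> shift n y \<in> topspace P"
  by (simp add: P_topspace)

lemma orbit_closure_subset_P: "orbit_closure y \<subseteq> topspace P"
  by (simp add: orbit_closure_def closure_of_subset_topspace)

lemma K_subset_P: "K \<subseteq> topspace P"
  unfolding K_def by (rule orbit_closure_subset_P)

lemma closedin_orbit_closure: "closedin P (orbit_closure y)"
  by (simp add: orbit_closure_def)

lemma shift_mem_orbit_closure: "y \<in> topspace P \<Longrightarrow> shift n y \<in> orbit_closure y"
  unfolding orbit_closure_def by (rule subsetD[OF closure_of_subset]) auto

lemma self_mem_orbit_closure: "y \<in> topspace P \<Longrightarrow> y \<in> orbit_closure y"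
  using shift_mem_orbit_closure[of y 0] by simp

lemma shift_orbit_closure:
  assumes "z \<in> orbit_closure y"
  shows "shift n z \<in> orbit_closure y"
proof -
  have "shift n ` orbit_closure y \<subseteq> P closure_of (shift n ` range (\<lambda>n. shift n y))"
    unfolding orbit_closure_def using continuous_shift by (rule continuous_map_image_closure_subset)
  also have "\<dots> \<subseteq> orbit_closure y"
    unfolding orbit_closure_def by (rule closure_of_mono) auto
  finally show ?thesis
    using assms by blast
qed

lemma orbit_closure_mono:
  assumes "z \<in> orbit_closure y"
  shows "orbit_closure z \<subseteq> orbit_closure y"
  unfolding orbit_closure_def[of z]
  using shift_orbit_closure[OF assms] by (intro closure_of_minimal closedin_orbit_closure) auto

lemma flip_orbit_closure:
  assumes "z \<in> orbit_closure y"
  shows "flip z \<in> orbit_closure (flip y)"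
proof -
  have "flip ` orbit_closure y \<subseteq> P closure_of (flip ` range (\<lambda>n. shift n y))"
    unfolding orbit_closure_def using continuous_flip by (rule continuous_map_image_closure_subset)
  also have "\<dots> \<subseteq> orbit_closure (flip y)"
    unfolding orbit_closure_def by (rule closure_of_mono) (auto simp: flip_shift)
  finally show ?thesis
    using assms by blast
qed

text \<open>Relations involving positions are in general only closed conditions, so they are checked
  along the orbit of \<open>y0\<close> and pass to the closure.\<close>

lemma K_induct:
  assumes "y \<in> K" "closedin P {y \<in> topspace P. Q y}" "\<And>n. Q (shift n y0)"
  shows "Q y"
proof -
  have "K \<subseteq> {y \<in> topspace P. Q y}"
    unfolding K_def orbit_closure_def using assms(2,3) y0_P
    by (intro closure_of_minimal) auto
  then show ?thesis
    using assms(1) by blast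
qed

text \<open>Labels are discrete, so agreement at finitely many places is an open condition and is
  attained exactly on the orbit of \<open>y0\<close>. Cocycle identities for \<open>disp\<close>
  thus carry over to \<open>K\<close>.\<close>

lemma K_approx:
  assumes "y \<in> K" "finite F"
  obtains n where "\<And>k g. (k, g) \<in> F \<Longrightarrow> lab y k g = disp g (k + n)"
proof -
  define U where "U = topspace P \<inter> (\<Inter>(k, g)\<in>F. {z \<in> topspace P. lab z k g = lab y k g})"
  have "openin P {z \<in> topspace P. lab z k g = v}" for k g v
    using lab_clopen(1)[of k g "{v}"] by simp
  then have "openin P U"
    unfolding U_def using assms(2) by (intro openin_Int_Inter) auto
  moreover have "y \<in> U"
    using assms(1) K_subset_P by (auto simp: U_def)
  ultimately obtain z where "z \<in> range (\<lambda>n. shift n y0)" "z \<in> U"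
    using assms(1) unfolding K_def orbit_closure_def in_closure_of by blast
  then obtain n where "shift n y0 \<in> U"
    by blast
  then have "lab y k g = disp g (k + n)" if "(k, g) \<in> F" for k g
    using that by (fastforce simp: U_def)
  then show thesis
    by (rule that)
qed

lemma lab_one: "y \<in> K \<Longrightarrow> lab y k \<one>\<^bsub>H\<^esub> = 0"
  using K_approx[of y "{(k, \<one>\<^bsub>H\<^esub>)}"] disp_one by auto

lemma lab_mult:
  assumes "y \<in> K" "g \<in> \<Gamma>" "h \<in> \<Gamma>"
  shows "lab y k (g \<otimes>\<^bsub>H\<^esub> h) = lab y k h + lab y (k + lab y k h) g"
proof -
  let ?F = "{(k, g \<otimes>\<^bsub>H\<^esub> h), (k, h), (k + lab y k h, g)}"
  obtain n where "\<And>j f. (j, f) \<in> ?F \<Longrightarrow> lab y j f = disp f (j + n)"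
    using K_approx[OF assms(1), of ?F] by blast
  then have "lab y k (g \<otimes>\<^bsub>H\<^esub> h) = disp (g \<otimes>\<^bsub>H\<^esub> h) (k + n)" "lab y k h = disp h (k + n)"
      "lab y (k + lab y k h) g = disp g (k + lab y k h + n)"
    by blast+
  then show ?thesis
    using assms(2,3) by (simp add: disp_mult add_ac)
qed

lemma apply_pos:
  assumes "y \<in> K" "g \<in> \<Gamma>"
  shows "g (pos y k) = pos y (k + lab y k g)"
proof -
  \<comment> \<open>The index of the target position depends on y, so its value d is fixed first;
    the premise is then clopen and the implication closed.\<close>
  have "lab y k g = d \<longrightarrow> g (pos y k) = pos y (k + d)" for d
    using assms(1)
  proof (rule K_induct)
    have "continuous_map P X (g \<circ> (\<lambda>y. pos y k))"
      using continuous_pos \<Gamma>_carrier[OF assms(2)]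
      by (intro continuous_map_compose) (auto simp: homeo_group_simps homeomorphic_imp_continuous_map)
    then have "closedin P {y \<in> topspace P. g (pos y k) = pos y (k + d)}"
      using closedin_continuous_maps_eq[OF Hausdorff _ continuous_pos] by (simp add: o_def)
    then have "closedin P ({y \<in> topspace P. lab y k g \<in> - {d}} \<union> {y \<in> topspace P. g (pos y k) = pos y (k + d)})"
      using lab_clopen(2) by (intro closedin_Un)
    moreover have "{y \<in> topspace P. lab y k g \<in> - {d}} \<union> {y \<in> topspace P. g (pos y k) = pos y (k + d)} =
        {y \<in> topspace P. lab y k g = d \<longrightarrow> g (pos y k) = pos y (k + d)}"
      by auto
    ultimately show "closedin P {y \<in> topspace P. lab y k g = d \<longrightarrow> g (pos y k) = pos y (k + d)}"
      by simp
    show "lab (shift n y0) k g = d \<longrightarrow> g (pos (shift n y0) k) = pos (shift n y0) (k + d)" for n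
      using apply_c[OF assms(2), of "k + n"] by (auto simp: add_ac)
  qed
  then show ?thesis
    by simp
qed

text \<open>An odd shift of \<open>y0\<close> starts with a b-edge. The two phases are separately
  closed, so every limit is in one of them.\<close>

lemma pos_is_line:
  assumes "y \<in> K"
  shows "is_line (pos y) \<or> is_line (\<lambda>k. pos y (k + 1))"
  using assms
proof (rule K_induct)
  have closed: "closedin P {y \<in> topspace P. is_line (\<lambda>k. pos y (k + m))}" for m
  proof -
    have "continuous_map P X (edge k \<circ> (\<lambda>y. pos y (k + m)))" for k
      using continuous_pos homeomorphic_imp_continuous_map[OF edge_homeo] by (rule continuous_map_compose)
    then have "closedin P {y \<in> topspace P. pos y (k + 1 + m) = edge k (pos y (k + m))}" for k
      using closedin_continuous_maps_eq[OF Hausdorff continuous_pos] by (simp add: o_def)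
    then have "closedin P (\<Inter>k. {y \<in> topspace P. pos y (k + 1 + m) = edge k (pos y (k + m))})"
      by (intro closedin_Inter) auto
    moreover have "(\<Inter>k. {y \<in> topspace P. pos y (k + 1 + m) = edge k (pos y (k + m))}) =
        {y \<in> topspace P. is_line (\<lambda>k. pos y (k + m))}"
      by (auto simp: is_line_def P_topspace)
    ultimately show ?thesis
      by simp
  qed
  have "closedin P ({y \<in> topspace P. is_line (pos y)} \<union> {y \<in> topspace P. is_line (\<lambda>k. pos y (k + 1))})"
    using closed[of 0] closed[of 1] by (intro closedin_Un) simp_all
  then show "closedin P {y \<in> topspace P. is_line (pos y) \<or> is_line (\<lambda>k. pos y (k + 1))}"
    by (simp add: Collect_disj_eq[symmetric] conj_disj_distribL)
  fix n
  show "is_line (pos (shift n y0)) \<or> is_line (\<lambda>k. pos (shift n y0) (k + 1))"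
  proof (cases "even n")
    case True
    then have "is_line (\<lambda>k. c (k + n))"
      by (intro is_line_shift[OF is_line_c])
    moreover have "pos (shift n y0) = (\<lambda>k. c (k + n))"
      by auto
    ultimately show ?thesis
      by simp
  next
    case False
    then have "is_line (\<lambda>k. c (k + (1 + n)))"
      by (intro is_line_shift[OF is_line_c]) auto
    then show ?thesis
      by (simp add: add.assoc)
  qed
qed

text \<open>On an injective line the positions determine the labels by \<open>apply_pos\<close>;
  outside \<Gamma> the bound \<open>bd\<close> leaves only 0.\<close>

lemma lab_eqI:
  assumes y: "y \<in> K" and "inj (pos y)" and eq: "\<And>g. g \<in> \<Gamma> \<Longrightarrow> g (pos y k) = pos y (k + d g)"
    and zero: "\<And>g. g \<notin> \<Gamma> \<Longrightarrow> d g = 0"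
  shows "lab y k g = d g"
proof (cases "g \<in> \<Gamma>")
  case True
  then have "pos y (k + lab y k g) = pos y (k + d g)"
    using apply_pos[OF y True] eq by metis
  then show ?thesis
    using assms(2) by (auto simp: inj_eq)
next
  case False
  then have "\<bar>lab y k g\<bar> \<le> 0"
    using y K_subset_P P_topspace[of y] by (metis bd_def subsetD)
  then show ?thesis
    using zero[OF False] by simp
qed

text \<open>Over a point with free orbit only the orientation of the line remains undetermined, hence
  \<open>flip\<close>; this is what makes the orbit closure of \<open>y0\<close> minimal.\<close>

lemma over_base_point:
  assumes z: "z \<in> K" and base: "pos z 0 = c 0"
  shows "z = y0 \<or> z = flip y0"
proof -
  have disp_zero: "g \<notin> \<Gamma> \<Longrightarrow> disp g k = 0" for g k
    by (simp add: disp_def)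
  from pos_is_line[OF z] show ?thesis
  proof
    assume "is_line (pos z)"
    then have pos: "pos z = c"
      using is_line_c base by (rule is_line_eqI)
    have "lab z k g = disp g k" for k g
      by (rule lab_eqI[OF z]) (auto simp: pos inj_c apply_c disp_zero)
    then have "z = y0"
      using pos by (intro eq_by_pos_lab) auto
    then show ?thesis ..
  next
    assume "is_line (\<lambda>k. pos z (k + 1))"
    \<comment> \<open>Reflecting the shifted line with m = -1 yields k ->
      \<open>pos z (- k)\<close>, which passes through \<open>c 0\<close> at index 0.\<close>
    then have "is_line (\<lambda>k. pos z (- 1 - k + 1))"
      by (rule is_line_reflect) simp
    then have "(\<lambda>k. pos z (- 1 - k + 1)) = c"
      using is_line_c by (rule is_line_eqI[of _ _ 0]) (simp add: base)
    then have pos: "pos z k = c (- k)" for k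
      by (auto simp: fun_eq_iff dest: spec[of _ "- k"])
    have "inj (pos z)"
      using inj_c by (auto simp: pos inj_eq intro!: injI)
    then have "lab z k g = - disp g (- k)" for k g
      by (intro lab_eqI[OF z]) (auto simp: pos apply_c disp_zero)
    then have "z = flip y0"
      using pos by (intro eq_by_pos_lab) auto
    then show ?thesis ..
  qed
qed

text \<open>The positions occurring at 0 in an orbit closure form a compact, hence closed set, and
  this set contains a dense line.\<close>

lemma pos_orbit_closure:
  assumes y: "y \<in> K" and x: "x \<in> S"
  obtains z where "z \<in> orbit_closure y" "pos z 0 = x"
proof -
  have yP: "y \<in> topspace P"
    using y K_subset_P by blast
  let ?M = "(\<lambda>z. pos z 0) ` orbit_closure y"
  have "compactin P (orbit_closure y)"
    using compact_P closedin_orbit_closure by (rule closedin_compact_space)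
  then have "compactin X ?M"
    using continuous_pos by (rule image_compactin)
  then have "closedin X ?M"
    using Hausdorff by (simp add: compactin_imp_closedin)
  moreover have "range (pos y) \<subseteq> ?M"
  proof safe
    fix n
    show "pos y n \<in> ?M"
      using shift_mem_orbit_closure[OF yP, of n] by (intro image_eqI[of _ _ "shift n y"]) auto
  qed
  ultimately have "X closure_of (range (pos y)) \<subseteq> ?M"
    by (simp add: closure_of_minimal)
  moreover have "X closure_of (range (pos y)) = S"
    using pos_is_line[OF y]
  proof
    assume "is_line (\<lambda>k. pos y (k + 1))"
    moreover have "range (\<lambda>k. pos y (k + 1)) = range (pos y)"
      by (metis (no_types) surj_plus_right image_image)
    ultimately show ?thesis
      using line_dense by metis
  qed (rule line_dense)
  ultimately show thesis
    using x that by blast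
qed

text \<open>It suffices to find \<open>y0\<close> in the orbit closure of y. Some point of that
  closure lies over \<open>c 0\<close>, and \<open>over_base_point\<close> leaves two
  candidates.\<close>

lemma orbit_closure_eq_K:
  assumes y: "y \<in> K"
  shows "orbit_closure y = K"
proof
  show sub: "orbit_closure y \<subseteq> K"
    using y unfolding K_def by (rule orbit_closure_mono)
  obtain z where z: "z \<in> orbit_closure y" "pos z 0 = c 0"
    using pos_orbit_closure[OF y c_mem] by blast
  have "z \<in> K"
    using z(1) sub by blast
  then consider "z = y0" | "z = flip y0"
    using over_base_point z(2) by blast
  then show "K \<subseteq> orbit_closure y"
  proof cases
    case 1
    then show ?thesis
      using z(1) unfolding K_def by (intro orbit_closure_mono) simp
  next
    case 2
    \<comment> \<open>Here z is the reversal of \<open>y0\<close> and a limit of its shifts.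
      Reversing everything shows that \<open>y0\<close> is a limit of shifts of z.\<close>
    have "flip z \<in> orbit_closure (flip y0)"
      using \<open>z \<in> K\<close> unfolding K_def by (rule flip_orbit_closure)
    then have "y0 \<in> orbit_closure z"
      using 2 by simp
    then have "y0 \<in> orbit_closure y"
      using orbit_closure_mono[OF z(1)] by blast
    then show ?thesis
      unfolding K_def by (rule orbit_closure_mono)
  qed
qed

lemma y0_K: "y0 \<in> K"
  unfolding K_def using y0_P by (rule self_mem_orbit_closure)

lemma shift_K [simp]: "y \<in> K \<Longrightarrow> shift n y \<in> K"
  unfolding K_def by (rule shift_orbit_closure)

lemma orbit_meets_open:
  assumes "y \<in> K" "openin P U" "z \<in> U" "z \<in> K"
  obtains n where "shift n y \<in> U"
proof -
  have "z \<in> orbit_closure y"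
    using assms(4) orbit_closure_eq_K[OF assms(1)] by simp
  then show thesis
    using assms(2,3) that unfolding orbit_closure_def in_closure_of by blast
qed

section \<open>The Cantor system on the orbit closure\<close>

definition Y :: "(int \<Rightarrow> 'a \<times> (('a \<Rightarrow> 'a) \<Rightarrow> int)) topology" where
  "Y = subtopology P K"

lemma Y_topspace [simp]: "topspace Y = K"
  unfolding Y_def using K_subset_P by (simp add: inf_absorb2)

lemma compactin_K: "compactin P K"
  using compact_P closedin_orbit_closure unfolding K_def by (rule closedin_compact_space)

lemma lab_clopen_Y: "openin Y {y \<in> K. lab y k g = d}" "closedin Y {y \<in> K. lab y k g = d}"
proof -
  have eq: "{y \<in> K. lab y k g = d} = {y \<in> topspace P. lab y k g \<in> {d}} \<inter> K"
    using K_subset_P by auto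
  show "openin Y {y \<in> K. lab y k g = d}"
    unfolding eq Y_def by (rule openin_subtopology_Int) (rule lab_clopen)
  show "closedin Y {y \<in> K. lab y k g = d}"
    unfolding eq Y_def closedin_subtopology
    by (intro exI[of _ "{y \<in> topspace P. lab y k g \<in> {d}}"] conjI lab_clopen refl)
qed

lemma continuous_pos_Y: "continuous_map Y X (\<lambda>y. pos y k)"
  unfolding Y_def using continuous_pos by (rule continuous_map_from_subtopology)

lemma homeo_shift: "homeomorphic_maps Y Y (shift n) (shift (- n))"
proof -
  have "continuous_map Y Y (shift n)" for n
    unfolding Y_def using continuous_shift
    by (intro continuous_map_into_subtopology continuous_map_from_subtopology) (auto simp: K_subset_P inf_absorb2)
  then show ?thesis
    by (simp add: homeomorphic_maps_def)
qed

lemma K_orbit_dense: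
  assumes "y \<in> K"
  shows "Y closure_of (range (\<lambda>n. shift n y)) = K"
proof -
  have "K \<inter> range (\<lambda>n. shift n y) = range (\<lambda>n. shift n y)"
    using assms by auto
  then show ?thesis
    unfolding Y_def closure_of_subtopology using orbit_closure_eq_K[OF assms]
    by (simp add: orbit_closure_def)
qed

lemma K_over:
  assumes "x \<in> S" "y \<in> K"
  obtains z where "z \<in> K" "pos z 0 = x"
  using pos_orbit_closure[OF assms(2,1)] orbit_closure_eq_K[OF assms(2)] by metis

lemma cantor_Y: "cantor_set Y"
proof -
  obtain B where B: "\<And>n :: nat. openin X (B n)" "\<And>n. closedin X (B n)"
    "\<And>x y. \<lbrakk>x \<in> S; y \<in> S; x \<noteq> y\<rbrakk> \<Longrightarrow> \<exists>n. (x \<in> B n) \<noteq> (y \<in> B n)"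
    using cantor_set_separating_clopens[OF cantor] by metis
  \<comment> \<open>Only labels of \<Gamma> enter, which keeps the family countable; all other
    labels are 0 on \<open>K\<close>.\<close>
  define \<B> where "\<B> = range (\<lambda>(k, n). {y \<in> K. pos y k \<in> B n}) \<union>
    (\<lambda>(k, g, d). {y \<in> K. lab y k g = d}) ` (UNIV \<times> \<Gamma> \<times> UNIV)"
  show ?thesis
  proof (rule cantor_setI)
    show "compact_space Y"
      unfolding Y_def using compactin_K by (simp add: compact_space_subtopology)
    show "topspace Y \<noteq> {}"
      using y0_K by (auto simp del: null_topspace_iff_trivial)
    show "countable \<B>"
      unfolding \<B>_def using countable_\<Gamma> by auto
    show "openin Y U \<and> closedin Y U" if "U \<in> \<B>" for U
      using that openin_continuous_map_preimage[OF continuous_pos_Y B(1)]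
        closedin_continuous_map_preimage[OF continuous_pos_Y B(2)] lab_clopen_Y
      by (auto simp: \<B>_def)
    show "\<exists>U\<in>\<B>. (y \<in> U) \<noteq> (z \<in> U)" if "y \<in> topspace Y" "z \<in> topspace Y" "y \<noteq> z" for y z
    proof -
      have yz: "y \<in> K" "z \<in> K"
        using that by auto
      consider k where "pos y k \<noteq> pos z k" | k g where "lab y k g \<noteq> lab z k g"
        using eq_by_pos_lab \<open>y \<noteq> z\<close> by blast
      then show ?thesis
      proof cases
        case 1
        then obtain n where "(pos y k \<in> B n) \<noteq> (pos z k \<in> B n)"
          using B(3) yz K_subset_P P_topspace by blast
        moreover have "{y \<in> K. pos y k \<in> B n} \<in> \<B>"
          unfolding \<B>_def by auto
        ultimately show ?thesis
          using yz by (intro bexI[of _ "{y \<in> K. pos y k \<in> B n}"]) auto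
      next
        case 2
        have "\<bar>lab y k g\<bar> \<le> bd g" "\<bar>lab z k g\<bar> \<le> bd g"
          using yz K_subset_P P_topspace by blast+
        then have "g \<in> \<Gamma>"
          using 2 by (cases "g \<in> \<Gamma>") (auto simp: bd_def)
        then have "{y' \<in> K. lab y' k g = lab y k g} \<in> \<B>"
          unfolding \<B>_def by (intro UnI2 image_eqI[of _ _ "(k, g, lab y k g)"]) auto
        then show ?thesis
          using yz 2 by (intro bexI[of _ "{y' \<in> K. lab y' k g = lab y k g}"]) auto
      qed
    qed
    show "\<not> openin Y {y}" if y: "y \<in> topspace Y" for y
    proof
      assume "openin Y {y}"
      then obtain U where U: "openin P U" "{y} = U \<inter> K"
        unfolding Y_def openin_subtopology by blast
      \<comment> \<open>By minimality every orbit enters the open set {y}. So y lies on the orbit of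
        a point over each x, and its own line visits all of X, which is uncountable.\<close>
      have "S \<subseteq> range (pos y)"
      proof
        fix x assume "x \<in> S"
        then obtain z where z: "z \<in> K" "pos z 0 = x"
          using K_over[of x y] y by auto
        obtain n where "shift n z \<in> U"
          using orbit_meets_open[OF z(1) U(1), of y] U(2) by blast
        then have "shift n z = y"
          using U(2) shift_K[OF z(1)] by blast
        then have "pos y (- n) = x"
          using z(2) by auto
        then show "x \<in> range (pos y)"
          by blast
      qed
      then have "countable S"
        by (rule countable_subset) simp
      then show False
        using uncountable_space by simp
    qed
  qed
qed

text \<open>Where the label at 0 is constant, this is a fixed power of the shift. These pieces are
  clopen, which will place \<open>hat g\<close> for g in \<Gamma> in the topological full
  group.\<close>

definition hat :: "('a \<Rightarrow> 'a) \<Rightarrow> (int \<Rightarrow> 'a \<times> (('a \<Rightarrow> 'a) \<Rightarrow> int)) \<Rightarrow> int \<Rightarrow> 'a \<times> (('a \<Rightarrow> 'a) \<Rightarrow> int)" where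
  "hat g y = shift (lab y 0 g) y"

lemma hat_K [simp]: "y \<in> K \<Longrightarrow> hat g y \<in> K"
  by (simp add: hat_def)

lemma hat_one: "y \<in> K \<Longrightarrow> hat \<one>\<^bsub>H\<^esub> y = y"
  by (simp add: hat_def lab_one)

lemma hat_mult: "\<lbrakk>y \<in> K; g \<in> \<Gamma>; h \<in> \<Gamma>\<rbrakk> \<Longrightarrow> hat (g \<otimes>\<^bsub>H\<^esub> h) y = hat g (hat h y)"
  using lab_mult[of y g h 0] by (simp add: hat_def add.commute)

text \<open>The position at 0 is an equivariant map onto X; through it the lifted action inherits
  faithfulness.\<close>

lemma pos_hat: "\<lbrakk>y \<in> K; g \<in> \<Gamma>\<rbrakk> \<Longrightarrow> pos (hat g y) 0 = g (pos y 0)"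
  using apply_pos[of y g 0] by (simp add: hat_def)

lemma continuous_hat: "continuous_map Y Y (hat g)"
  unfolding continuous_map_def
proof (intro conjI allI impI)
  fix U assume U: "openin Y U"
  have "{y \<in> topspace Y. hat g y \<in> U} = (\<Union>d. {y \<in> K. lab y 0 g = d} \<inter> {y \<in> topspace Y. shift d y \<in> U})"
    by (auto simp: hat_def)
  moreover have "openin Y ({y \<in> K. lab y 0 g = d} \<inter> {y \<in> topspace Y. shift d y \<in> U})" for d
    using homeo_shift[of d] U unfolding homeomorphic_maps_def
    by (intro openin_Int lab_clopen_Y openin_continuous_map_preimage) auto
  ultimately show "openin Y {y \<in> topspace Y. hat g y \<in> U}"
    by auto
qed auto

lemma homeo_hat:
  assumes "g \<in> \<Gamma>"
  shows "homeomorphic_maps Y Y (hat g) (hat (inv\<^bsub>H\<^esub> g))"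
proof -
  have "hat (inv\<^bsub>H\<^esub> g) (hat g y) = y" "hat g (hat (inv\<^bsub>H\<^esub> g) y) = y" if "y \<in> K" for y
    using that assms \<Gamma>_inv[OF assms] \<Gamma>_carrier[OF assms]
    by (simp_all add: hat_mult[symmetric] hat_one)
  then show ?thesis
    by (simp add: homeomorphic_maps_def continuous_hat)
qed

text \<open>By minimality and compactness, finitely many shifts suffice to bring every point of
  \<open>K\<close> into the neighbourhood of \<open>y0\<close> given by the window; their sizes
  bound the gaps.\<close>

lemma uniform_recurrence:
  assumes F: "finite F"
  shows "\<exists>L. \<forall>i. \<exists>t. i \<le> t \<and> t \<le> i + L \<and> (\<forall>g\<in>F. \<forall>j. \<bar>j\<bar> \<le> R \<longrightarrow> disp g (t + j) = disp g j)"
proof -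
  define U where "U = topspace P \<inter> (\<Inter>(j, g)\<in>{-R..R} \<times> F. {z \<in> topspace P. lab z j g = disp g j})"
  have "openin P {z \<in> topspace P. lab z k g = v}" for k g v
    using lab_clopen(1)[of k g "{v}"] by simp
  then have U: "openin P U"
    unfolding U_def using F by (intro openin_Int_Inter) auto
  have y0_U: "y0 \<in> U"
    using y0_P by (auto simp: U_def)
  let ?V = "\<lambda>n. {z \<in> topspace P. shift n z \<in> U}"
  have open_V: "openin P V" if "V \<in> range ?V" for V
    using that openin_continuous_map_preimage[OF continuous_shift U] by auto
  have cover: "K \<subseteq> \<Union>(range ?V)"
  proof
    fix y assume y: "y \<in> K"
    then obtain n where "shift n y \<in> U"
      using orbit_meets_open[OF y U y0_U y0_K] by blast
    then show "y \<in> \<Union>(range ?V)"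
      using y K_subset_P by auto
  qed
  have "\<exists>\<F>. finite \<F> \<and> \<F> \<subseteq> range ?V \<and> K \<subseteq> \<Union>\<F>"
    by (rule compactinD[OF compactin_K open_V cover])
  then obtain \<F> where \<F>: "finite \<F>" "\<F> \<subseteq> range ?V" "K \<subseteq> \<Union>\<F>"
    by (elim exE conjE)
  obtain N where "finite N" "\<F> = ?V ` N"
    using finite_subset_image[OF \<F>(1,2)] by (elim exE conjE)
  then have N: "finite N" "K \<subseteq> (\<Union>n\<in>N. ?V n)"
    using \<F>(3) by simp_all
  define L where "L = Max (insert 0 (abs ` N))"
  have L: "\<bar>n\<bar> \<le> L" if "n \<in> N" for n
    unfolding L_def using that N(1) by (intro Max_ge) auto
  have "\<exists>t. i \<le> t \<and> t \<le> i + 2 * L \<and> (\<forall>g\<in>F. \<forall>j. \<bar>j\<bar> \<le> R \<longrightarrow> disp g (t + j) = disp g j)" for i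
  proof -
    \<comment> \<open>Starting at i + L, a correction between -L and L lands between i and
      \<open>i + 2 * L\<close>.\<close>
    have "shift (i + L) y0 \<in> K"
      using y0_K by simp
    then obtain n where n: "n \<in> N" "shift n (shift (i + L) y0) \<in> U"
      using N(2) by blast
    let ?t = "n + (i + L)"
    have "i \<le> ?t" "?t \<le> i + 2 * L"
      using L[OF n(1)] by auto
    moreover have "disp g (?t + j) = disp g j" if "g \<in> F" "\<bar>j\<bar> \<le> R" for g j
    proof -
      have "(j, g) \<in> {-R..R} \<times> F"
        using that by auto
      then have "lab (shift n (shift (i + L) y0)) j g = disp g j"
        using n(2) unfolding U_def by blast
      then show ?thesis
        by (simp add: add_ac)
    qed
    ultimately show ?thesis
      by blast
  qed
  then show ?thesis
    by blast
qed

section \<open>Amenability and the embedding\<close>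

lemma subgroup_generated_by_simps [simp]:
  "carrier (subgroup_generated_by X (A \<union> B)) = \<Gamma>"
  "\<one>\<^bsub>subgroup_generated_by X (A \<union> B)\<^esub> = \<one>\<^bsub>H\<^esub>"
  "g \<otimes>\<^bsub>subgroup_generated_by X (A \<union> B)\<^esub> h = g \<otimes>\<^bsub>H\<^esub> h"
  by (simp_all add: subgroup_generated_by_def \<Gamma>_def)

lemma group_fragmentation: "group (subgroup_generated_by X (A \<union> B))"
  unfolding subgroup_generated_by_def
  using subgroup.subgroup_is_group[OF subgroup_\<Gamma> H.is_group] by (simp add: \<Gamma>_def)

lemma amenable_fragmentation: "amenable (subgroup_generated_by X (A \<union> B))"
proof -
  interpret recurrent_displacement "subgroup_generated_by X (A \<union> B)" disp
  proof (intro recurrent_displacement.intro recurrent_displacement_axioms.intro group_fragmentation)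
    show "\<exists>C. \<forall>k. \<bar>disp g k\<bar> \<le> C" for g
      using disp_le_bd by blast
  qed (auto simp: disp_one disp_mult disp_faithful uniform_recurrence)
  show ?thesis
    by (rule amenable)
qed

lemma embedding_into_topological_full_group:
  obtains Z :: "(nat \<Rightarrow> bool) topology" and \<phi> :: "int \<Rightarrow> (nat \<Rightarrow> bool) \<Rightarrow> (nat \<Rightarrow> bool)" and \<iota>
  where "cantor_set Z" "minimal_action integer_group Z \<phi>"
    "\<iota> \<in> mon (subgroup_generated_by X (A \<union> B)) (topological_full_group integer_group Z \<phi>)"
proof -
  \<comment> \<open>The target is the standard Cantor space, whose type does not depend on that of
    X; the dynamics of \<open>Y\<close> are conjugated to it by \<open>e\<close>.\<close>
  define Z where "Z = product_topology (\<lambda>n::nat. discrete_topology (UNIV :: bool set)) UNIV"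
  obtain e e' where e: "homeomorphic_maps Y Z e e'"
    using cantor_Y unfolding cantor_set_def Z_def homeomorphic_space_def by blast
  have e_map: "homeomorphic_map Y Z e"
    using e homeomorphic_maps_map by blast
  have cont_e': "continuous_map Z Y e'"
    using e by (simp add: homeomorphic_maps_def)
  have e'_K: "e' x \<in> K" if "x \<in> topspace Z" for x
    using cont_e' that by (auto simp: continuous_map_def)
  have e_Z: "e y \<in> topspace Z" "e' (e y) = y" if "y \<in> K" for y
    using e that by (auto simp: homeomorphic_maps_def continuous_map_def)
  define \<phi> where "\<phi> n = (\<lambda>x\<in>topspace Z. e (shift n (e' x)))" for n
  define \<iota> where "\<iota> g = (\<lambda>x\<in>topspace Z. e (hat g (e' x)))" for g
  have \<phi>_carrier: "\<phi> n \<in> carrier (homeo_group Z)" for n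
    unfolding \<phi>_def using e homeo_shift by (rule transport_carrier)
  have \<iota>_carrier: "\<iota> g \<in> carrier (homeo_group Z)" if "g \<in> \<Gamma>" for g
    unfolding \<iota>_def using e homeo_hat[OF that] by (rule transport_carrier)
  have "cantor_set Z"
    unfolding cantor_set_def Z_def by (rule homeomorphic_space_refl)
  moreover have "minimal_action integer_group Z \<phi>"
    unfolding minimal_action_def
  proof (intro conjI ballI)
    show "group_hom integer_group (homeo_group Z) \<phi>"
    proof (intro group_hom.intro group_hom_axioms.intro homI group_integer_group group_homeo_group)
      show "\<phi> (m \<otimes>\<^bsub>integer_group\<^esub> n) = \<phi> m \<otimes>\<^bsub>homeo_group Z\<^esub> \<phi> n" for m n
        unfolding \<phi>_def
        by (subst transport_mult[OF e homeo_shift homeo_shift homeo_shift[of "m + n"]]) simp_all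
    qed (rule \<phi>_carrier)
    fix x assume x: "x \<in> topspace Z"
    have "orbit integer_group \<phi> x = e ` range (\<lambda>n. shift n (e' x))"
      using x by (auto simp: orbit_def \<phi>_def)
    moreover have "Z closure_of (e ` range (\<lambda>n. shift n (e' x))) = e ` K"
      using e'_K[OF x] by (subst homeomorphic_map_closure_of[OF e_map]) (auto simp: K_orbit_dense)
    moreover have "e ` K = topspace Z"
      using homeomorphic_imp_surjective_map[OF e_map] by simp
    ultimately show "Z closure_of (orbit integer_group \<phi> x) = topspace Z"
      by simp
  qed
  moreover have "\<iota> \<in> mon (subgroup_generated_by X (A \<union> B)) (topological_full_group integer_group Z \<phi>)"
    unfolding mon_def
  proof (intro CollectI conjI homI)
    fix g assume "g \<in> carrier (subgroup_generated_by X (A \<union> B))"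
    then have g: "g \<in> \<Gamma>"
      by simp
    have "\<exists>U n. openin Z U \<and> x \<in> U \<and> (\<forall>x'\<in>U. \<iota> g x' = \<phi> n x')" if x: "x \<in> topspace Z" for x
    proof -
      let ?d = "lab (e' x) 0 g"
      let ?U = "{x' \<in> topspace Z. e' x' \<in> {y \<in> K. lab y 0 g = ?d}}"
      have "openin Z ?U"
        using cont_e' lab_clopen_Y(1) by (rule openin_continuous_map_preimage)
      moreover have "x \<in> ?U"
        using x e'_K by simp
      moreover have "\<forall>x'\<in>?U. \<iota> g x' = \<phi> ?d x'"
        by (simp add: \<iota>_def \<phi>_def hat_def)
      ultimately show ?thesis
        by blast
    qed
    then show "\<iota> g \<in> carrier (topological_full_group integer_group Z \<phi>)"
      using \<iota>_carrier[OF g] by (simp add: topological_full_group_def)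
  next
    fix g h assume "g \<in> carrier (subgroup_generated_by X (A \<union> B))" "h \<in> carrier (subgroup_generated_by X (A \<union> B))"
    then have "g \<in> \<Gamma>" "h \<in> \<Gamma>"
      by simp_all
    then have "\<iota> (g \<otimes>\<^bsub>H\<^esub> h) = \<iota> g \<otimes>\<^bsub>homeo_group Z\<^esub> \<iota> h"
      unfolding \<iota>_def
      by (subst transport_mult[OF e homeo_hat homeo_hat homeo_hat[of "g \<otimes>\<^bsub>H\<^esub> h"]])
        (simp_all add: \<Gamma>_mult hat_mult)
    then show "\<iota> (g \<otimes>\<^bsub>subgroup_generated_by X (A \<union> B)\<^esub> h) =
        \<iota> g \<otimes>\<^bsub>topological_full_group integer_group Z \<phi>\<^esub> \<iota> h"
      by (simp add: topological_full_group_def)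
  next
    show "inj_on \<iota> (carrier (subgroup_generated_by X (A \<union> B)))"
    proof (rule inj_onI)
      fix g h assume "g \<in> carrier (subgroup_generated_by X (A \<union> B))" "h \<in> carrier (subgroup_generated_by X (A \<union> B))"
        and eq: "\<iota> g = \<iota> h"
      then have gh: "g \<in> \<Gamma>" "h \<in> \<Gamma>"
        by simp_all
      \<comment> \<open>Some point of \<open>K\<close> lies over x; equality of the lifts there
        projects to equality at x.\<close>
      have "g x = h x" if x: "x \<in> S" for x
      proof -
        obtain y where y: "y \<in> K" "pos y 0 = x"
          using K_over[OF x y0_K] .
        have "e (hat g y) = e (hat h y)"
          using fun_cong[OF eq, of "e y"] e_Z[OF y(1)] by (simp add: \<iota>_def)
        then have "hat g y = hat h y"
          using e_Z(2) hat_K[OF y(1)] by metis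
        then show ?thesis
          using pos_hat[OF y(1)] gh y(2) by metis
      qed
      then show "g = h"
        using gh \<Gamma>_carrier by (intro homeo_group_eqI) auto
    qed
  qed
  ultimately show thesis
    by (rule that)
qed

end

theorem proposition4p3:
  fixes X :: "'a topology" and a b :: "'a \<Rightarrow> 'a" and G :: "('a \<Rightarrow> 'a) monoid"
  assumes "cantor_set X"
    and "period_two X a" and "period_two X b"
    and "minimal_action (subgroup_generated_by X {a, b}) X (\<lambda>h. h)"
    and "dihedral_fragmentation X a b G"
  shows "(\<exists>(Y :: (nat \<Rightarrow> bool) topology) (\<phi> :: int \<Rightarrow> (nat \<Rightarrow> bool) \<Rightarrow> (nat \<Rightarrow> bool)) \<iota>.
            cantor_set Y \<and> minimal_action integer_group Y \<phi> \<and>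
            \<iota> \<in> mon G (topological_full_group integer_group Y \<phi>))
         \<and> amenable G"
proof -
  obtain A B where AB: "fragmentation X a A" "fragmentation X b B" and G: "G = subgroup_generated_by X (A \<union> B)"
    using assms(5) unfolding dihedral_fragmentation_def by blast
  interpret fragmented_dihedral_action X a b A B
    by unfold_locales (fact assms AB)+
  show ?thesis
    unfolding G using embedding_into_topological_full_group amenable_fragmentation by metis
qed

end
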